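(* Let $N$ be a left $\mathcal{A}^{\mathbb{R}}_\star$-comodule with coaction map $\psi_L:N\to\mathcal{A}^{\mathbb{R}}_\star\otimes_{\mathbb{M}_2^{\mathbb{R}}}N$, and give $N$ the left $\mathcal{A}^{\mathbb{R}}$-module structure $\varphi\cdot n=(\varphi c\otimes\mathrm{id})\psi_L(n)$ for $\varphi\in\mathcal{A}^{\mathbb{R}}$, $n\in N$. Then for all $n\in N$, $$\psi_L(n)=\sum_i c(\mathbf{b}_i)\otimes(\mathbf{B}^i\cdot n),$$ where $\{\mathbf{b}_i\}$ is the monomial basis of $\mathcal{A}^{\mathbb{R}}_\star$ as a left $\mathbb{M}_2^{\mathbb{R}}$-module and $\{\mathbf{B}^i\}\subset\mathcal{A}^{\mathbb{R}}$ is the dual basis.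
   Context: $\mathbb{M}_2^{\mathbb{R}}=\mathbb{F}_2[\tau,\rho]$ (homological bidegrees $|\tau|=(0,-1)$, $|\rho|=(-1,-1)$). The $\mathbb{R}$-motivic dual Steenrod algebra is $\mathcal{A}^{\mathbb{R}}_\star=\mathbb{M}_2^{\mathbb{R}}[\tau_0,\tau_1,\dots,\xi_1,\xi_2,\dots]/(\tau_n^2=\tau\xi_{n+1}+\rho\tau_0\xi_{n+1}+\rho\tau_{n+1})$, $|\tau_i|=(2^{i+1}-1,2^i-1)$, $|\xi_i|=(2^{i+1}-2,2^i-1)$, a Hopf algebroid over $\mathbb{M}_2^{\mathbb{R}}$ with units $\eta_L(\tau)=\tau$, $\eta_R(\tau)=\tau+\rho\tau_0$, $\eta_L(\rho)=\eta_R(\rho)=\rho$; comultiplication $\Delta(\xi_n)=\sum_{i=0}^n\xi_{n-i}^{2^i}\otimes\xi_i$, $\Delta(\tau_n)=\tau_n\otimes1+\sum_{i=0}^n\xi_{n-i}^{2^i}\otimes\tau_i$ ($\xi_0=1$); counit killing all $\tau_i$ and all $\xi_i$, $i\ge1$; and conjugation $c$, the ring map (an involution) with $c(\rho)=\rho$, $c(\tau)=\tau+\rho\tau_0$, $c(\xi_n)=\sum_{i=0}^{n-1}\xi_{n-i}^{2^i}c(\xi_i)$, $c(\tau_n)=\tau_n+\sum_{i=0}^{n-1}\xi_{n-i}^{2^i}c(\tau_i)$. The left and right $\mathbb{M}_2^{\mathbb{R}}$-module structures on $\mathcal{A}^{\mathbb{R}}_\star$ are multiplication through $\eta_L$ and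 $\eta_R$; $c$ interchanges them. In $\mathcal{A}^{\mathbb{R}}_\star\otimes_{\mathbb{M}_2^{\mathbb{R}}}N$ the right structure on $\mathcal{A}^{\mathbb{R}}_\star$ is used; a left comodule is an $\mathbb{M}_2^{\mathbb{R}}$-module $N$ with a left $\mathbb{M}_2^{\mathbb{R}}$-linear, coassociative, counital coaction. The $\mathbb{R}$-motivic Steenrod algebra is $\mathcal{A}^{\mathbb{R}}=\mathrm{Hom}_{\mathbb{M}_2^{\mathbb{R}}}(\mathcal{A}^{\mathbb{R}}_\star,\mathbb{M}_2^{\mathbb{R}})$ (bigraded left-linear maps), with product $(\varphi\psi)(a)=\sum\varphi(a'\,\eta_R(\psi(a'')))$ where $\Delta(a)=\sum a'\otimes a''$. $\varphi c$ denotes the composite of $c$ followed by $\varphi$; it is right $\mathbb{M}_2^{\mathbb{R}}$-linear. The monomial basis consists of the $\prod\tau_i^{e_i}\prod\xi_j^{r_j}$ with $e_i\in\{0,1\}$, $r_j\ge0$ (finitely many nonzero exponents), and $\mathbf{B}^i(\mathbf{b}_j)=\delta_{ij}$. *)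

theory Defs
  imports "HOL-Library.Poly_Mapping" "HOL-Library.Z2" "HOL-Library.Multiset" "HOL-Library.Product_Plus"
begin

section \<open>Polynomial rings\<close>

text \<open>
  The polynomial ring over \<open>'c\<close> in the variables \<open>'v\<close> is the type \<open>('v \<Rightarrow>\<^sub>0 nat) \<Rightarrow>\<^sub>0 'c\<close>
  with the convolution product of the library.
\<close>

definition ring_map :: "('a::comm_ring_1 \<Rightarrow> 'b::comm_ring_1) \<Rightarrow> bool" where
  "ring_map f \<longleftrightarrow> f 1 = 1 \<and> (\<forall>x y. f (x + y) = f x + f y) \<and> (\<forall>x y. f (x * y) = f x * f y)"

definition monom_eval :: "('v \<Rightarrow> 'r::comm_ring_1) \<Rightarrow> ('v \<Rightarrow>\<^sub>0 nat) \<Rightarrow> 'r" where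
  "monom_eval g e = (\<Prod>v\<in>Poly_Mapping.keys e. g v ^ Poly_Mapping.lookup e v)"

definition poly_eval ::
  "('c \<Rightarrow> 'r::comm_ring_1) \<Rightarrow> ('v \<Rightarrow> 'r) \<Rightarrow> (('v \<Rightarrow>\<^sub>0 nat) \<Rightarrow>\<^sub>0 'c::comm_ring_1) \<Rightarrow> 'r" where
  "poly_eval f g p = (\<Sum>e\<in>Poly_Mapping.keys p. f (Poly_Mapping.lookup p e) * monom_eval g e)"

definition pvar :: "'v \<Rightarrow> (('v \<Rightarrow>\<^sub>0 nat) \<Rightarrow>\<^sub>0 'c::comm_ring_1)" where
  "pvar v = Poly_Mapping.single (Poly_Mapping.single v 1) 1"

definition pconst :: "'c \<Rightarrow> (('v \<Rightarrow>\<^sub>0 nat) \<Rightarrow>\<^sub>0 'c::comm_ring_1)" where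
  "pconst c = Poly_Mapping.single 0 c"

lemma ring_mapD:
  assumes "ring_map f"
  shows "f 1 = 1" "f (x + y) = f x + f y" "f (x * y) = f x * f y" "f 0 = 0" "f (- x) = - f x"
    "f (x - y) = f x - f y"
proof -
  show 1: "f 1 = 1" "\<And>x y. f (x + y) = f x + f y" "f (x * y) = f x * f y"
    using assms by (auto simp: ring_map_def)
  have "f (0 + 0) = f 0 + f 0" by (rule 1)
  then show 0: "f 0 = 0" by simp
  have neg: "f (- x) = - f x" for x
    using 1(2)[of x "- x"] 0 by (simp add: eq_neg_iff_add_eq_0 add.commute)
  show "f (- x) = - f x" by (rule neg)
  show "f (x - y) = f x - f y"
    using 1(2)[of x "- y"] neg[of y] by simp
qed

lemma ring_map_sum: "ring_map f \<Longrightarrow> f (sum g A) = (\<Sum>x\<in>A. f (g x))"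
  by (induction A rule: infinite_finite_induct) (auto simp: ring_mapD)

lemma ring_map_power: "ring_map f \<Longrightarrow> f (x ^ n) = f x ^ n"
  by (induction n) (auto simp: ring_mapD)

lemma poly_mapping_add_induct [case_names zero add]:
  assumes "P 0" and "\<And>a b p. P p \<Longrightarrow> P (Poly_Mapping.single a b + p)"
  shows "P (p :: 'a \<Rightarrow>\<^sub>0 'b::comm_monoid_add)"
proof (induction p rule: update_induct)
  case const
  show ?case by (rule assms(1))
next
  case (update f a b)
  have "Poly_Mapping.update a b f = Poly_Mapping.single a b + f"
    using update by (intro poly_mapping_eqI)
      (auto simp: lookup_update lookup_add lookup_single when_def in_keys_iff)
  then show ?case using assms(2) update by simp
qed

lemma monom_eval_superset:
  assumes "finite S" "Poly_Mapping.keys e \<subseteq> S"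
  shows "monom_eval g e = (\<Prod>v\<in>S. g v ^ Poly_Mapping.lookup e v)"
  unfolding monom_eval_def using assms
  by (intro prod.mono_neutral_left) (auto simp: in_keys_iff)

lemma monom_eval_add: "monom_eval g (e + e') = monom_eval g e * monom_eval g e'"
proof -
  let ?S = "Poly_Mapping.keys e \<union> Poly_Mapping.keys e'"
  have "Poly_Mapping.keys (e + e') \<subseteq> ?S" by (rule Poly_Mapping.keys_add)
  then show ?thesis
    using monom_eval_superset[of ?S "e + e'" g] monom_eval_superset[of ?S e g]
      monom_eval_superset[of ?S e' g]
    by (simp add: lookup_add power_add prod.distrib)
qed

lemma monom_eval_zero [simp]: "monom_eval g 0 = 1"
  by (simp add: monom_eval_def)

lemma poly_eval_superset:
  assumes "f 0 = 0" "finite S" "Poly_Mapping.keys p \<subseteq> S"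
  shows "poly_eval f g p = (\<Sum>e\<in>S. f (Poly_Mapping.lookup p e) * monom_eval g e)"
  unfolding poly_eval_def using assms
  by (intro sum.mono_neutral_left) (auto simp: in_keys_iff)

lemma poly_eval_add:
  assumes f: "ring_map f"
  shows "poly_eval f g (p + q) = poly_eval f g p + poly_eval f g q"
proof -
  let ?S = "Poly_Mapping.keys p \<union> Poly_Mapping.keys q"
  have "Poly_Mapping.keys (p + q) \<subseteq> ?S" by (rule Poly_Mapping.keys_add)
  then show ?thesis
    using poly_eval_superset[of f ?S "p + q" g] poly_eval_superset[of f ?S p g]
      poly_eval_superset[of f ?S q g] ring_mapD[OF f]
    by (simp add: lookup_add sum.distrib algebra_simps)
qed

lemma poly_eval_single:
  assumes f: "ring_map f"
  shows "poly_eval f g (Poly_Mapping.single e c) = f c * monom_eval g e"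
  using ring_mapD(4)[OF f] by (cases "c = 0") (auto simp: poly_eval_def)

lemma poly_eval_pconst: "ring_map f \<Longrightarrow> poly_eval f g (pconst c) = f c"
  by (simp add: pconst_def poly_eval_single)

lemma poly_eval_pvar: "ring_map f \<Longrightarrow> poly_eval f g (pvar v) = g v"
  by (simp add: pvar_def poly_eval_single ring_mapD monom_eval_def)

lemma poly_eval_ring_map:
  assumes f: "ring_map f"
  shows "ring_map (poly_eval f g)"
proof -
  have z: "poly_eval f g 0 = 0" by (simp add: poly_eval_def)
  have s: "poly_eval f g (Poly_Mapping.single e c * q) = f c * monom_eval g e * poly_eval f g q" for e c q
    by (induction q rule: poly_mapping_add_induct)
      (simp_all add: z poly_eval_add[OF f] poly_eval_single[OF f] mult_single distrib_left
        monom_eval_add ring_mapD[OF f] mult_ac)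
  have m: "poly_eval f g (p * q) = poly_eval f g p * poly_eval f g q" for p q
    by (induction p rule: poly_mapping_add_induct)
      (simp_all add: z poly_eval_add[OF f] poly_eval_single[OF f] s distrib_right)
  have "poly_eval f g 1 = 1"
    using poly_eval_single[OF f, of g 0 1] ring_mapD(1)[OF f] by simp
  then show ?thesis unfolding ring_map_def using poly_eval_add[OF f] m by blast
qed

lemma pconst_ring_map: "ring_map pconst"
  by (simp add: ring_map_def pconst_def single_add mult_single)

lemma poly_ring_map_eqI:
  assumes f: "ring_map (f :: (('v \<Rightarrow>\<^sub>0 nat) \<Rightarrow>\<^sub>0 'c::comm_ring_1) \<Rightarrow> 'r::comm_ring_1)" and f': "ring_map f'"
    and c: "\<And>c. f (pconst c) = f' (pconst c)" and v: "\<And>v. f (pvar v) = f' (pvar v)"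
  shows "f p = f' p"
proof -
  have pw: "f (Poly_Mapping.single (Poly_Mapping.single a b) 1)
      = f' (Poly_Mapping.single (Poly_Mapping.single a b) 1)" for a b
  proof (induction b)
    case 0
    show ?case using ring_mapD(1)[OF f] ring_mapD(1)[OF f'] by simp
  next
    case (Suc b)
    have "Poly_Mapping.single (Poly_Mapping.single a (Suc b)) (1::'c)
        = pvar a * Poly_Mapping.single (Poly_Mapping.single a b) 1"
      by (simp add: pvar_def mult_single flip: single_add)
    then show ?case using Suc v[of a] by (simp add: ring_mapD(3)[OF f] ring_mapD(3)[OF f'])
  qed
  have mon: "f (Poly_Mapping.single e 1) = f' (Poly_Mapping.single e 1)" for e
  proof (induction e rule: poly_mapping_add_induct)
    case zero
    show ?case using ring_mapD(1)[OF f] ring_mapD(1)[OF f'] by simp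
  next
    case (add a b e)
    have "Poly_Mapping.single (Poly_Mapping.single a b + e) (1::'c)
      = Poly_Mapping.single (Poly_Mapping.single a b) 1 * Poly_Mapping.single e 1"
      by (simp add: mult_single)
    then show ?case using add pw[of a b] by (simp add: ring_mapD(3)[OF f] ring_mapD(3)[OF f'])
  qed
  show ?thesis
  proof (induction p rule: poly_mapping_add_induct)
    case zero
    show ?case by (simp add: ring_mapD(4)[OF f] ring_mapD(4)[OF f'])
  next
    case (add e b p)
    have "Poly_Mapping.single e b = pconst b * Poly_Mapping.single e 1"
      by (simp add: pconst_def mult_single)
    then show ?case using add c[of b] mon[of e]
      by (simp add: ring_mapD(2,3)[OF f] ring_mapD(2,3)[OF f'])
  qed
qed


section \<open>The coefficient ring and its modules\<close>

datatype m2_gen = TauM | RhoM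

type_synonym m2r = "(m2_gen \<Rightarrow>\<^sub>0 nat) \<Rightarrow>\<^sub>0 bit"

abbreviation m2_tau :: m2r where "m2_tau \<equiv> pvar TauM"
abbreviation m2_rho :: m2r where "m2_rho \<equiv> pvar RhoM"

lemma m2r_char2: "(1::m2r) + 1 = 0"
proof -
  have "(1::m2r) + 1 = Poly_Mapping.single 0 (1 + 1)"
    by (simp only: single_add single_one)
  then show ?thesis by simp
qed

class m2_module = ab_group_add +
  fixes m2_scale :: "m2r \<Rightarrow> 'a \<Rightarrow> 'a"  (infixr \<open>\<bullet>\<close> 75)
  assumes m2_scale_add_right: "m \<bullet> (x + y) = m \<bullet> x + m \<bullet> y"
    and m2_scale_add_left: "(m + m') \<bullet> x = m \<bullet> x + m' \<bullet> x"
    and m2_scale_scale: "m \<bullet> m' \<bullet> x = (m * m') \<bullet> x"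
    and m2_scale_one: "1 \<bullet> x = x"

class m2_algebra = m2_module + comm_ring_1 +
  assumes m2_scale_mult: "m \<bullet> (x * y) = (m \<bullet> x) * y"

lemma m2_scale_zero [simp]: "0 \<bullet> (x::'a::m2_module) = 0" "m \<bullet> (0::'a::m2_module) = 0"
  using m2_scale_add_left[of 0 0 x] m2_scale_add_right[of m 0 "0::'a"] by simp_all

lemma m2_char2: "x + x = (0::'a::m2_module)"
  using m2_scale_add_left[of 1 1 x] by (simp add: m2r_char2 m2_scale_one del: one_add_one)

lemma m2_double: "(2::'a::m2_algebra) = 0" "x - y = x + (y::'a)"
proof -
  show "(2::'a) = 0" using m2_char2[of "1::'a"] by simp
  show "x - y = x + y" using m2_char2[of y] by (simp add: diff_eq_eq add.assoc)
qed

lemma m2_frobenius: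
  "(x + y) ^ 2 = x ^ 2 + (y::'a::m2_algebra) ^ 2"
  "(\<Sum>i\<in>A. f i) ^ 2 = (\<Sum>i\<in>A. (f i :: 'a) ^ 2)"
proof -
  show 1: "(x + y) ^ 2 = x ^ 2 + y ^ 2" for x y :: 'a
    by (simp add: power2_sum m2_double mult.assoc)
  show "(\<Sum>i\<in>A. f i) ^ 2 = (\<Sum>i\<in>A. f i ^ 2)"
    by (induction A rule: infinite_finite_induct) (auto simp: 1)
qed


section \<open>The dual Steenrod algebra\<close>

text \<open>\<open>XiVar k\<close> is the generator \<open>\<xi>\<close> with index \<open>k + 1\<close>, as \<open>\<xi>\<close> with index \<open>0\<close> is the unit.\<close>

datatype gen = TauVar nat | XiVar nat

type_synonym dst_pre = "(gen \<Rightarrow>\<^sub>0 nat) \<Rightarrow>\<^sub>0 m2r"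

definition dst_rel :: "nat \<Rightarrow> dst_pre" where
  "dst_rel n = (pvar (TauVar n))\<^sup>2 -
     (pconst m2_tau * pvar (XiVar n) + pconst m2_rho * pvar (TauVar 0) * pvar (XiVar n)
      + pconst m2_rho * pvar (TauVar (Suc n)))"

inductive_set dst_ideal :: "dst_pre set" where
  zero_mem: "0 \<in> dst_ideal"
| add_mult_rel: "p \<in> dst_ideal \<Longrightarrow> p + q * dst_rel n \<in> dst_ideal"

lemma dst_ideal_add: "p \<in> dst_ideal \<Longrightarrow> q \<in> dst_ideal \<Longrightarrow> p + q \<in> dst_ideal"
  by (rotate_tac, induction q rule: dst_ideal.induct)
    (auto intro: dst_ideal.add_mult_rel simp flip: add.assoc)

lemma dst_ideal_mult: "p \<in> dst_ideal \<Longrightarrow> r * p \<in> dst_ideal"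
  by (induction p rule: dst_ideal.induct)
    (auto intro: dst_ideal.intros simp: distrib_left simp flip: mult.assoc)

lemma dst_ideal_uminus: "p \<in> dst_ideal \<Longrightarrow> - p \<in> dst_ideal"
  using dst_ideal_mult[of p "- 1"] by simp

lemma dst_rel_in_ideal: "dst_rel n \<in> dst_ideal"
  using dst_ideal.add_mult_rel[OF dst_ideal.zero_mem, of 1 n] by simp

lemma ring_map_dst_ideal:
  assumes "ring_map f" "\<And>n. f (dst_rel n) = 0" "p \<in> dst_ideal"
  shows "f p = 0"
  using assms(3) by induction (simp_all add: ring_mapD[OF assms(1)] assms(2))

lemma one_notin_dst_ideal: "1 \<notin> dst_ideal"
proof
  define f :: "dst_pre \<Rightarrow> m2r" where "f = poly_eval (\<lambda>m. m) (\<lambda>_. 0)"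
  have id: "ring_map (\<lambda>m::m2r. m)" by (simp add: ring_map_def)
  have f: "ring_map f" unfolding f_def by (rule poly_eval_ring_map[OF id])
  have v: "f (pvar v) = 0" for v by (simp add: f_def poly_eval_pvar[OF id])
  have "f (dst_rel n) = 0" for n
    by (simp add: dst_rel_def ring_mapD[OF f] ring_map_power[OF f] v)
  moreover assume "1 \<in> dst_ideal"
  ultimately have "f 1 = 0" using ring_map_dst_ideal[OF f] by blast
  then show False using ring_mapD(1)[OF f] by simp
qed

quotient_type dual_steenrod = dst_pre / "\<lambda>p q. p - q \<in> dst_ideal"
  morphisms dst_rep dst_class
proof (rule equivpI)
  show "reflp (\<lambda>p q. p - q \<in> dst_ideal)" by (simp add: reflp_def dst_ideal.zero_mem)
  show "symp (\<lambda>p q. p - q \<in> dst_ideal)"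
    using dst_ideal_uminus by (fastforce simp: symp_def)
  show "transp (\<lambda>p q. p - q \<in> dst_ideal)"
  proof (rule transpI)
    fix p q r :: dst_pre
    assume "p - q \<in> dst_ideal" "q - r \<in> dst_ideal"
    then have "(p - q) + (q - r) \<in> dst_ideal" by (rule dst_ideal_add)
    then show "p - r \<in> dst_ideal" by simp
  qed
qed

instantiation dual_steenrod :: comm_ring_1
begin

lift_definition zero_dual_steenrod :: dual_steenrod is 0 .
lift_definition one_dual_steenrod :: dual_steenrod is 1 .
lift_definition plus_dual_steenrod :: "dual_steenrod \<Rightarrow> dual_steenrod \<Rightarrow> dual_steenrod" is "(+)"
proof -
  fix p p' q q' :: dst_pre
  assume "p - p' \<in> dst_ideal" "q - q' \<in> dst_ideal"
  then have "(p - p') + (q - q') \<in> dst_ideal" by (rule dst_ideal_add)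
  then show "p + q - (p' + q') \<in> dst_ideal" by (simp add: algebra_simps)
qed
lift_definition minus_dual_steenrod :: "dual_steenrod \<Rightarrow> dual_steenrod \<Rightarrow> dual_steenrod" is "(-)"
proof -
  fix p p' q q' :: dst_pre
  assume "p - p' \<in> dst_ideal" "q - q' \<in> dst_ideal"
  then have "(p - p') + - (q - q') \<in> dst_ideal" by (intro dst_ideal_add dst_ideal_uminus)
  then show "p - q - (p' - q') \<in> dst_ideal" by (simp add: algebra_simps)
qed
lift_definition uminus_dual_steenrod :: "dual_steenrod \<Rightarrow> dual_steenrod" is uminus
  using dst_ideal_uminus by fastforce
lift_definition times_dual_steenrod :: "dual_steenrod \<Rightarrow> dual_steenrod \<Rightarrow> dual_steenrod" is "(*)"
proof -
  fix p p' q q' :: dst_pre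
  assume "p - p' \<in> dst_ideal" "q - q' \<in> dst_ideal"
  then have "q * (p - p') + p' * (q - q') \<in> dst_ideal" by (intro dst_ideal_add dst_ideal_mult)
  then show "p * q - p' * q' \<in> dst_ideal" by (simp add: algebra_simps)
qed

instance
proof
  show "(0::dual_steenrod) \<noteq> 1"
    using one_notin_dst_ideal dst_ideal_uminus[of "- 1"] by transfer auto
qed (transfer; simp add: algebra_simps dst_ideal.zero_mem)+

end

lemma dst_class_ring_map: "ring_map dst_class"
  by (simp add: ring_map_def one_dual_steenrod.abs_eq plus_dual_steenrod.abs_eq
      times_dual_steenrod.abs_eq)

lemma dst_class_rep: "dst_class (dst_rep a) = a"
  using Quotient3_abs_rep[OF Quotient3_dual_steenrod] .

definition eta_L :: "m2r \<Rightarrow> dual_steenrod" where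
  "eta_L m = dst_class (pconst m)"

definition dst_gen :: "gen \<Rightarrow> dual_steenrod" where
  "dst_gen v = dst_class (pvar v)"

definition dtau :: "nat \<Rightarrow> dual_steenrod" where
  "dtau n = dst_gen (TauVar n)"

fun dxi :: "nat \<Rightarrow> dual_steenrod" where
  "dxi 0 = 1"
| "dxi (Suc n) = dst_gen (XiVar n)"

lemma eta_L_ring_map: "ring_map eta_L"
proof -
  have "ring_map (pconst :: m2r \<Rightarrow> dst_pre)" by (rule pconst_ring_map)
  then show ?thesis using dst_class_ring_map by (simp add: ring_map_def eta_L_def)
qed

lemmas eta_L_simps = ring_mapD[OF eta_L_ring_map]

lemma dtau_squared:
  "(dtau n)\<^sup>2 = eta_L m2_tau * dxi (Suc n) + eta_L m2_rho * dtau 0 * dxi (Suc n)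
     + eta_L m2_rho * dtau (Suc n)"
proof -
  have "dst_class (dst_rel n) = dst_class 0"
    using dst_rel_in_ideal[of n] by (simp add: dual_steenrod.abs_eq_iff)
  then have "dst_class (dst_rel n) = 0" by (simp add: zero_dual_steenrod.abs_eq)
  then show ?thesis
    unfolding dst_rel_def
    by (simp add: ring_mapD[OF dst_class_ring_map] ring_map_power[OF dst_class_ring_map]
        dtau_def dst_gen_def eta_L_def)
qed

lemma dual_steenrod_ring_map_eqI:
  fixes f f' :: "dual_steenrod \<Rightarrow> 'r::comm_ring_1"
  assumes f: "ring_map f" and f': "ring_map f'" and m: "\<And>m. f (eta_L m) = f' (eta_L m)"
    and t: "\<And>n. f (dtau n) = f' (dtau n)" and x: "\<And>n. f (dxi n) = f' (dxi n)"
  shows "f a = f' a"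
proof -
  have comp: "ring_map (\<lambda>p. h (dst_class p))" if "ring_map h" for h :: "dual_steenrod \<Rightarrow> 'r"
    using that dst_class_ring_map by (simp add: ring_map_def)
  have v: "f (dst_class (pvar v)) = f' (dst_class (pvar v))" for v
  proof (cases v)
    case (TauVar n)
    then show ?thesis using t[of n] by (simp add: dtau_def dst_gen_def)
  next
    case (XiVar n)
    then show ?thesis using x[of "Suc n"] by (simp add: dst_gen_def)
  qed
  have "f (dst_class p) = f' (dst_class p)" for p
    by (rule poly_ring_map_eqI[OF comp[OF f] comp[OF f']])
      (use m v in \<open>simp_all add: eta_L_def\<close>)
  from this[of "dst_rep a"] show ?thesis by (simp add: dst_class_rep)
qed

text \<open>
  The \<open>m2_module\<close> structure of \<open>dual_steenrod\<close> is the left one; the right structure is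
  \<open>\<lambda>a m. a * eta_R m\<close>.
\<close>

instantiation dual_steenrod :: m2_algebra
begin

definition m2_scale_dual_steenrod :: "m2r \<Rightarrow> dual_steenrod \<Rightarrow> dual_steenrod" where
  "m \<bullet> a = eta_L m * a"

instance
  by standard (simp_all add: m2_scale_dual_steenrod_def eta_L_simps algebra_simps)

end

definition eta_R :: "m2r \<Rightarrow> dual_steenrod" where
  "eta_R = poly_eval (\<lambda>b. eta_L (pconst b))
     (case_m2_gen (eta_L m2_tau + eta_L m2_rho * dtau 0) (eta_L m2_rho))"

lemma eta_L_pconst_ring_map: "ring_map (\<lambda>b::bit. eta_L (pconst b))"
proof -
  have "ring_map (pconst :: bit \<Rightarrow> m2r)" by (rule pconst_ring_map)
  then show ?thesis using eta_L_ring_map by (simp add: ring_map_def)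
qed

lemma eta_R_ring_map: "ring_map eta_R"
  unfolding eta_R_def by (rule poly_eval_ring_map[OF eta_L_pconst_ring_map])

lemmas eta_R_simps = ring_mapD[OF eta_R_ring_map]

lemma eta_R_tau: "eta_R m2_tau = eta_L m2_tau + eta_L m2_rho * dtau 0"
  by (simp add: eta_R_def poly_eval_pvar[OF eta_L_pconst_ring_map])

lemma eta_R_rho: "eta_R m2_rho = eta_L m2_rho"
  by (simp add: eta_R_def poly_eval_pvar[OF eta_L_pconst_ring_map])

lemma eta_R_pconst: "eta_R (pconst b) = eta_L (pconst b)"
  by (simp add: eta_R_def poly_eval_pconst[OF eta_L_pconst_ring_map])

text \<open>
  A ring map on polynomials descends to \<open>dual_steenrod\<close> as soon as it kills the relations
  (\<open>dst_lift_class\<close>, \<open>dst_lift_ring_map\<close>); this is checked below for the counit, the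
  comultiplication and the conjugation.
\<close>

definition dst_lift :: "(dst_pre \<Rightarrow> 'r) \<Rightarrow> dual_steenrod \<Rightarrow> 'r" where
  "dst_lift f a = f (dst_rep a)"

lemma dst_lift_class:
  assumes f: "ring_map f" and r: "\<And>n. f (dst_rel n) = 0"
  shows "dst_lift f (dst_class p) = f p"
proof -
  have "dst_class (dst_rep (dst_class p)) = dst_class p" by (rule dst_class_rep)
  then have "dst_rep (dst_class p) - p \<in> dst_ideal" by (simp add: dual_steenrod.abs_eq_iff)
  then have "f (dst_rep (dst_class p) - p) = 0" by (rule ring_map_dst_ideal[OF f r])
  then show ?thesis by (simp add: dst_lift_def ring_mapD(6)[OF f])
qed

lemma dst_lift_ring_map:
  assumes f: "ring_map f" and r: "\<And>n. f (dst_rel n) = 0"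
  shows "ring_map (dst_lift f)"
proof -
  note l = dst_lift_class[OF assms]
  note c = ring_mapD[OF dst_class_ring_map]
  have "dst_lift f 1 = 1" using l[of 1] by (simp add: c ring_mapD[OF f])
  moreover have "dst_lift f (a + b) = dst_lift f a + dst_lift f b" for a b
    using l[of "dst_rep a + dst_rep b"] by (simp add: c dst_class_rep ring_mapD[OF f] dst_lift_def)
  moreover have "dst_lift f (a * b) = dst_lift f a * dst_lift f b" for a b
    using l[of "dst_rep a * dst_rep b"] by (simp add: c dst_class_rep ring_mapD[OF f] dst_lift_def)
  ultimately show ?thesis by (simp add: ring_map_def)
qed

definition counit :: "dual_steenrod \<Rightarrow> m2r" where
  "counit = dst_lift (poly_eval (\<lambda>m. m) (\<lambda>_. 0))"

lemma
  shows counit_ring_map: "ring_map counit"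
    and counit_simps: "counit (eta_L m) = m" "counit (dtau n) = 0" "counit (dxi (Suc n)) = 0"
proof -
  define f :: "dst_pre \<Rightarrow> m2r" where "f = poly_eval (\<lambda>m. m) (\<lambda>_. 0)"
  have id: "ring_map (\<lambda>m::m2r. m)" by (simp add: ring_map_def)
  have f: "ring_map f" unfolding f_def by (rule poly_eval_ring_map[OF id])
  have v: "f (pvar v) = 0" for v by (simp add: f_def poly_eval_pvar[OF id])
  have r: "f (dst_rel n) = 0" for n
    by (simp add: dst_rel_def ring_mapD[OF f] ring_map_power[OF f] v)
  show "ring_map counit"
    unfolding counit_def using dst_lift_ring_map[OF f r] by (simp add: f_def)
  show "counit (eta_L m) = m" "counit (dtau n) = 0" "counit (dxi (Suc n)) = 0"
    using dst_lift_class[OF f r] v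
    by (simp_all add: eta_L_def dtau_def dst_gen_def counit_def f_def poly_eval_pconst[OF id])
qed

lemma counit_eta_R: "counit (eta_R m) = m"
proof (rule poly_ring_map_eqI[of "\<lambda>m. counit (eta_R m)" "\<lambda>m. m"])
  show "ring_map (\<lambda>m. counit (eta_R m))"
    using counit_ring_map eta_R_ring_map by (simp add: ring_map_def)
  show "ring_map (\<lambda>m::m2r. m)" by (simp add: ring_map_def)
  show "counit (eta_R (pconst b)) = pconst b" for b
    by (simp add: eta_R_pconst counit_simps)
  show "counit (eta_R (pvar v)) = pvar v" for v
    by (cases v) (simp_all add: eta_R_tau eta_R_rho ring_mapD[OF counit_ring_map] counit_simps)
qed


section \<open>Conjugation\<close>

fun conj_xi :: "nat \<Rightarrow> dual_steenrod" where
  "conj_xi 0 = 1"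
| "conj_xi (Suc n) = (\<Sum>i\<le>n. dxi (Suc n - i) ^ (2 ^ i) * conj_xi i)"

fun conj_tau :: "nat \<Rightarrow> dual_steenrod" where
  "conj_tau n = dtau n + (\<Sum>i<n. dxi (n - i) ^ (2 ^ i) * conj_tau i)"

declare conj_tau.simps [simp del]

definition dst_conj :: "dual_steenrod \<Rightarrow> dual_steenrod" where
  "dst_conj = dst_lift (poly_eval eta_R (case_gen conj_tau (\<lambda>k. conj_xi (Suc k))))"

lemma conj_tau_squared:
  "(conj_tau n)\<^sup>2 = eta_L m2_tau * conj_xi (Suc n) + eta_L m2_rho * conj_tau (Suc n)"
proof (induction n rule: less_induct)
  case (less n)
  let ?t = "eta_L m2_tau" and ?r = "eta_L m2_rho"
  have sq: "(dxi (n - i) ^ (2 ^ i))\<^sup>2 = dxi (n - i) ^ (2 ^ Suc i)" for i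
    by (simp add: mult.commute flip: power_mult)
  have "(conj_tau n)\<^sup>2 = (dtau n)\<^sup>2 + (\<Sum>i<n. (dxi (n - i) ^ (2 ^ i))\<^sup>2 * (conj_tau i)\<^sup>2)"
    by (subst conj_tau.simps) (simp add: m2_frobenius power_mult_distrib)
  also have "(\<Sum>i<n. (dxi (n - i) ^ (2 ^ i))\<^sup>2 * (conj_tau i)\<^sup>2)
      = (\<Sum>i<n. dxi (n - i) ^ (2 ^ Suc i) * (?t * conj_xi (Suc i) + ?r * conj_tau (Suc i)))"
    by (intro sum.cong refl) (simp only: sq less lessThan_iff)
  also have "\<dots> = ?t * (\<Sum>i<n. dxi (n - i) ^ (2 ^ Suc i) * conj_xi (Suc i))
      + ?r * (\<Sum>i<n. dxi (n - i) ^ (2 ^ Suc i) * conj_tau (Suc i))"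
    by (simp add: sum_distrib_left algebra_simps flip: sum.distrib del: conj_xi.simps)
  also have "(\<Sum>i<n. dxi (n - i) ^ (2 ^ Suc i) * conj_xi (Suc i)) = conj_xi (Suc n) - dxi (Suc n)"
    by (subst (2) conj_xi.simps)
      (simp add: sum.atMost_shift lessThan_Suc_atMost del: conj_xi.simps(2) dxi.simps power_Suc)
  also have "(\<Sum>i<n. dxi (n - i) ^ (2 ^ Suc i) * conj_tau (Suc i))
      = conj_tau (Suc n) - dtau (Suc n) - dxi (Suc n) * dtau 0"
    by (subst (2) conj_tau.simps, subst sum.lessThan_Suc_shift)
      (simp add: conj_tau.simps[of 0] del: dxi.simps power_Suc)
  finally show ?case
    by (simp add: dtau_squared m2_double algebra_simps del: dxi.simps conj_xi.simps)
qed

lemma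
  shows dst_conj_ring_map: "ring_map dst_conj"
    and dst_conj_eta_L: "dst_conj (eta_L m) = eta_R m"
    and dst_conj_dtau: "dst_conj (dtau n) = conj_tau n"
    and dst_conj_dxi: "dst_conj (dxi n) = conj_xi n"
proof -
  define f where "f = poly_eval eta_R (case_gen conj_tau (\<lambda>k. conj_xi (Suc k)))"
  have f: "ring_map f" unfolding f_def by (rule poly_eval_ring_map[OF eta_R_ring_map])
  have v: "f (pvar v) = case_gen conj_tau (\<lambda>k. conj_xi (Suc k)) v" for v
    by (simp add: f_def poly_eval_pvar[OF eta_R_ring_map] del: conj_xi.simps)
  have c: "f (pconst m) = eta_R m" for m
    by (simp add: f_def poly_eval_pconst[OF eta_R_ring_map])
  have "f (dst_rel n) = (conj_tau n)\<^sup>2 - ((eta_L m2_tau + eta_L m2_rho * dtau 0) * conj_xi (Suc n)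
      + eta_L m2_rho * dtau 0 * conj_xi (Suc n) + eta_L m2_rho * conj_tau (Suc n))" for n
    by (simp add: dst_rel_def ring_mapD[OF f] ring_map_power[OF f] v c eta_R_tau eta_R_rho
        conj_tau.simps[of 0] del: conj_xi.simps)
  then have r: "f (dst_rel n) = 0" for n
    by (simp add: conj_tau_squared m2_double algebra_simps del: conj_xi.simps)
  note l = dst_lift_class[OF f r]
  have cc: "dst_conj = dst_lift f" by (simp add: dst_conj_def f_def)
  show "ring_map dst_conj" unfolding cc by (rule dst_lift_ring_map[OF f r])
  show "dst_conj (eta_L m) = eta_R m" by (simp add: cc eta_L_def l c)
  show "dst_conj (dtau n) = conj_tau n" by (simp add: cc dtau_def dst_gen_def l v)
  show "dst_conj (dxi n) = conj_xi n"
    by (cases n) (simp_all add: cc l v dst_gen_def ring_mapD[OF dst_lift_ring_map[OF f r]] del: conj_xi.simps(2))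
qed

lemma dst_conj_eta_R: "dst_conj (eta_R m) = eta_L m"
proof -
  have r: "ring_map (\<lambda>m. dst_conj (eta_R m))"
    using dst_conj_ring_map eta_R_ring_map by (simp add: ring_map_def)
  have "dst_conj (eta_R (pvar v)) = eta_L (pvar v)" for v
    by (cases v) (simp_all add: eta_R_tau eta_R_rho ring_mapD[OF dst_conj_ring_map] dst_conj_eta_L dst_conj_dtau
        conj_tau.simps[of 0] m2_char2 add.assoc)
  then show ?thesis
    by (rule poly_ring_map_eqI[OF r eta_L_ring_map, rotated]) (simp add: eta_R_pconst dst_conj_eta_L)
qed


section \<open>The tensor product\<close>

(* otherwise lift_definition would also unfold dual_steenrod *)
lifting_forget dual_steenrod.lifting

text \<open>
  \<open>'n dst_tensor\<close> is the tensor product over \<open>m2r\<close> of \<open>dual_steenrod\<close>, with its right structure,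
  and \<open>'n\<close>.  It is the free commutative monoid on the symbols \<open>(a, n)\<close> modulo the congruence
  generated by biadditivity and balancedness; the rule \<open>cong_zero\<close> makes the quotient a group, the
  inverse of \<open>(a, n)\<close> being \<open>(- a, n)\<close>.
\<close>

inductive tensor_cong ::
  "(dual_steenrod \<times> 'n::m2_module) multiset \<Rightarrow> (dual_steenrod \<times> 'n) multiset \<Rightarrow> bool" where
  cong_refl: "tensor_cong p p"
| cong_sym: "tensor_cong p q \<Longrightarrow> tensor_cong q p"
| cong_trans: "tensor_cong p q \<Longrightarrow> tensor_cong q r \<Longrightarrow> tensor_cong p r"
| cong_plus: "tensor_cong p q \<Longrightarrow> tensor_cong (p + r) (q + r)"
| cong_zero: "tensor_cong {#(0, n)#} {#}"
| cong_add_left: "tensor_cong {#(a + a', n)#} {#(a, n), (a', n)#}"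
| cong_add_right: "tensor_cong {#(a, n + n')#} {#(a, n), (a, n')#}"
| cong_balanced: "tensor_cong {#(a * eta_R m, n)#} {#(a, m \<bullet> n)#}"

quotient_type (overloaded) 'n dst_tensor =
  "(dual_steenrod \<times> 'n::m2_module) multiset" / tensor_cong
  by (rule equivpI) (auto simp: reflp_def symp_def transp_def intro: tensor_cong.intros)

definition balanced :: "(dual_steenrod \<Rightarrow> 'n::m2_module \<Rightarrow> 'b::comm_monoid_add) \<Rightarrow> bool" where
  "balanced f \<longleftrightarrow> (\<forall>n. f 0 n = 0) \<and> (\<forall>a a' n. f (a + a') n = f a n + f a' n)
     \<and> (\<forall>a n n'. f a (n + n') = f a n + f a n') \<and> (\<forall>a m n. f (a * eta_R m) n = f a (m \<bullet> n))"

instantiation dst_tensor :: (m2_module) comm_monoid_add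
begin

lift_definition zero_dst_tensor :: "'a dst_tensor" is "{#}" .
lift_definition plus_dst_tensor :: "'a dst_tensor \<Rightarrow> 'a dst_tensor \<Rightarrow> 'a dst_tensor" is "(+)"
  by (metis tensor_cong.cong_plus tensor_cong.cong_trans add.commute)

instance
  by standard (transfer; simp add: ac_simps tensor_cong.cong_refl)+

end

lift_definition tens :: "dual_steenrod \<Rightarrow> 'n::m2_module \<Rightarrow> 'n dst_tensor"  (infixl \<open>\<otimes>\<close> 76)
  is "\<lambda>a n. {#(a, n)#}" .

lemma tens_zero_left [simp]: "0 \<otimes> n = 0"
  by transfer (rule tensor_cong.cong_zero)

lemma tens_add_left: "(a + a') \<otimes> n = a \<otimes> n + a' \<otimes> n"
  by transfer (use tensor_cong.cong_add_left in \<open>simp add: add_mset_commute\<close>)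

lemma tens_add_right: "a \<otimes> (n + n') = a \<otimes> n + a \<otimes> n'"
  by transfer (use tensor_cong.cong_add_right in \<open>simp add: add_mset_commute\<close>)

lemma tens_balanced: "(a * eta_R m) \<otimes> n = a \<otimes> (m \<bullet> n)"
  by transfer (rule tensor_cong.cong_balanced)

lemma tens_zero_right [simp]: "a \<otimes> 0 = (0 :: 'n::m2_module dst_tensor)"
  using tens_balanced[of a 0 "0::'n"] by (simp add: eta_R_simps)

lemma tensor_induct [case_names zero add]:
  assumes "P 0" "\<And>a n t. P t \<Longrightarrow> P (a \<otimes> n + t)"
  shows "P (t :: 'n::m2_module dst_tensor)"
proof -
  have "P (abs_dst_tensor p)" for p
  proof (induction p)
    case empty
    show ?case using assms(1) by (simp add: zero_dst_tensor_def)
  next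
    case (add x p)
    obtain a n where "x = (a, n)" by fastforce
    then have "abs_dst_tensor (add_mset x p) = a \<otimes> n + abs_dst_tensor p"
      by (simp add: tens.abs_eq plus_dst_tensor.abs_eq)
    then show ?case using assms(2) add by simp
  qed
  from this[of "rep_dst_tensor t"] show ?thesis
    by (simp add: Quotient3_abs_rep[OF Quotient3_dst_tensor])
qed

text \<open>
  The additive map induced by a balanced map; the value \<open>0\<close> for other \<open>f\<close> is a dummy.
\<close>

lift_definition tensor_lift ::
  "(dual_steenrod \<Rightarrow> 'n::m2_module \<Rightarrow> 'b::comm_monoid_add) \<Rightarrow> 'n dst_tensor \<Rightarrow> 'b"
  is "\<lambda>f p. if balanced f then \<Sum>(a, n)\<in>#p. f a n else 0"
proof -
  fix f :: "dual_steenrod \<Rightarrow> 'n \<Rightarrow> 'b" and p q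
  have "(\<Sum>(a, n)\<in>#p. f a n) = (\<Sum>(a, n)\<in>#q. f a n)" if "tensor_cong p q" "balanced f"
    using that by (induction) (auto simp: balanced_def)
  then show "tensor_cong p q \<Longrightarrow> (if balanced f then \<Sum>(a, n)\<in>#p. f a n else 0)
      = (if balanced f then \<Sum>(a, n)\<in>#q. f a n else 0)" by auto
qed

lemma tensor_lift_zero [simp]: "tensor_lift f 0 = 0"
  by transfer simp

lemma tensor_lift_add [simp]: "tensor_lift f (s + t) = tensor_lift f s + tensor_lift f t"
  by transfer simp

lemma tensor_lift_tens: "balanced f \<Longrightarrow> tensor_lift f (a \<otimes> n) = f a n"
  by transfer simp

lemma balanced_add:
  "balanced f \<Longrightarrow> balanced g \<Longrightarrow> balanced (\<lambda>a n. f a n + g a n)"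
  by (auto simp: balanced_def ac_simps)

lemma tensor_lift_add_fun:
  assumes "balanced f" "balanced g"
  shows "tensor_lift (\<lambda>a n. f a n + g a n) t = tensor_lift f t + tensor_lift g t"
  by (induction t rule: tensor_induct)
    (simp_all add: tensor_lift_tens assms balanced_add ac_simps)

lemma balanced_mult_left: "balanced (\<lambda>a n. (b * a) \<otimes> n)"
  by (simp add: balanced_def tens_add_left tens_add_right tens_balanced distrib_left flip: mult.assoc)

instantiation dst_tensor :: (m2_module) m2_module
begin

definition uminus_dst_tensor :: "'a dst_tensor \<Rightarrow> 'a dst_tensor" where
  "- t = tensor_lift (\<lambda>a n. (- 1 * a) \<otimes> n) t"

definition minus_dst_tensor :: "'a dst_tensor \<Rightarrow> 'a dst_tensor \<Rightarrow> 'a dst_tensor" where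
  "s - t = s + (- (t :: 'a dst_tensor))"

definition m2_scale_dst_tensor :: "m2r \<Rightarrow> 'a dst_tensor \<Rightarrow> 'a dst_tensor" where
  "m \<bullet> t = tensor_lift (\<lambda>a n. (eta_L m * a) \<otimes> n) t"

instance
proof
  fix s t :: "'a dst_tensor" and m m' :: m2r
  show "- t + t = 0"
  proof (induction t rule: tensor_induct)
    case zero
    show ?case by (simp add: uminus_dst_tensor_def)
  next
    case (add a n t)
    have "- (a \<otimes> n + t) + (a \<otimes> n + t) = ((- 1 * a) \<otimes> n + a \<otimes> n) + (- t + t)"
      by (simp only: uminus_dst_tensor_def tensor_lift_add tensor_lift_tens[OF balanced_mult_left]
          add_ac)
    also have "(- 1 * a) \<otimes> n + a \<otimes> n = 0" by (simp flip: tens_add_left)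
    finally show ?case using add by simp
  qed
  have sc: "m \<bullet> (a \<otimes> n) = (eta_L m * a) \<otimes> n" "m \<bullet> 0 = (0 :: 'a dst_tensor)"
      "m \<bullet> (s + t) = m \<bullet> s + m \<bullet> t" for m a and n :: 'a and s t :: "'a dst_tensor"
    by (simp_all only: m2_scale_dst_tensor_def tensor_lift_tens[OF balanced_mult_left]
        tensor_lift_zero tensor_lift_add)
  show "s - t = s + - t" by (simp add: minus_dst_tensor_def)
  show "m \<bullet> (s + t) = m \<bullet> s + m \<bullet> t" by (simp add: m2_scale_dst_tensor_def)
  show "(m + m') \<bullet> t = m \<bullet> t + m' \<bullet> t"
    by (simp add: m2_scale_dst_tensor_def eta_L_simps distrib_right tens_add_left
        tensor_lift_add_fun balanced_mult_left)
  show "m \<bullet> m' \<bullet> t = (m * m') \<bullet> t"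
    by (induction t rule: tensor_induct) (simp_all add: sc eta_L_simps mult.assoc)
  show "1 \<bullet> t = t"
    by (induction t rule: tensor_induct)
      (simp_all add: sc eta_L_simps)
qed

end

lemma m2_scale_tens: "m \<bullet> (a \<otimes> n) = (eta_L m * a) \<otimes> n"
  by (simp add: m2_scale_dst_tensor_def tensor_lift_tens[OF balanced_mult_left])

text \<open>The tensor product with an algebra is a ring, by \<open>(a \<otimes> b) * (a' \<otimes> b') = (a * a') \<otimes> (b * b')\<close>.\<close>

lemma m2_scale_mult_right: "x * (m \<bullet> y) = m \<bullet> (x * (y::'b::m2_algebra))"
  by (metis m2_scale_mult mult.commute)

lemma balanced_tensor_mult_inner:
  "balanced (\<lambda>a' b'. (a * a') \<otimes> (b * (b'::'b::m2_algebra)))"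
  by (simp add: balanced_def tens_add_left tens_add_right tens_balanced distrib_left
      m2_scale_mult_right flip: mult.assoc)

lemma balanced_tensor_mult:
  "balanced (\<lambda>a b. tensor_lift (\<lambda>a' b'. (a * a') \<otimes> (b * (b'::'b::m2_algebra))) t)"
proof -
  note l = tensor_lift_tens[OF balanced_tensor_mult_inner]
  have 0: "tensor_lift (\<lambda>a' b'. (0 * a') \<otimes> (b * b')) t = 0" for b :: 'b
    by (induction t rule: tensor_induct) (simp_all add: tensor_lift_tens[OF balanced_tensor_mult_inner[of 0, simplified]])
  have 1: "tensor_lift (\<lambda>a' b'. ((a * eta_R m) * a') \<otimes> (b * b')) t
      = tensor_lift (\<lambda>a' b'. (a * a') \<otimes> ((m \<bullet> b) * b')) t" for a m and b :: 'b
  proof -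
    have "(a * eta_R m * a') \<otimes> (b * b') = (a * a') \<otimes> ((m \<bullet> b) * b')" for a' b'
    proof -
      have "a * eta_R m * a' = a * a' * eta_R m" by (simp add: mult_ac)
      then show ?thesis by (simp only: tens_balanced m2_scale_mult)
    qed
    then show ?thesis by simp
  qed
  show ?thesis
    unfolding balanced_def using 0 1
    by (auto simp: tens_add_left tens_add_right distrib_right tensor_lift_add_fun
        balanced_tensor_mult_inner)
qed

instantiation dst_tensor :: (m2_algebra) m2_algebra
begin

definition one_dst_tensor :: "'a dst_tensor" where
  "1 = 1 \<otimes> 1"

definition times_dst_tensor :: "'a dst_tensor \<Rightarrow> 'a dst_tensor \<Rightarrow> 'a dst_tensor" where
  "s * t = tensor_lift (\<lambda>a b. tensor_lift (\<lambda>a' b'. (a * a') \<otimes> (b * b')) t) s"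

lemma tens_times: "(a \<otimes> b) * t = tensor_lift (\<lambda>a' b'. (a * a') \<otimes> (b * (b'::'a))) t"
  by (simp only: times_dst_tensor_def tensor_lift_tens[OF balanced_tensor_mult])

lemma tens_mult: "(a \<otimes> b) * (a' \<otimes> b') = (a * a') \<otimes> (b * (b'::'a))"
  by (simp only: tens_times tensor_lift_tens[OF balanced_tensor_mult_inner])

instance
proof
  fix s t u :: "'a dst_tensor" and m :: m2r
  have dl: "(s + t) * u = s * u + t * u" for s t u :: "'a dst_tensor"
    by (simp add: times_dst_tensor_def)
  have z: "0 * t = 0" for t :: "'a dst_tensor" by (simp add: times_dst_tensor_def)
  have zr: "t * 0 = 0" for t :: "'a dst_tensor"
    by (induction t rule: tensor_induct)
      (simp_all add: z dl tens_times)
  have dr: "s * (t + u) = s * t + s * u" for s t u :: "'a dst_tensor"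
    by (induction s rule: tensor_induct)
      (simp_all add: z dl tens_times add_ac)
  show "(s + t) * u = s * u + t * u" by (rule dl)
  have c1: "(a \<otimes> b) * t = t * (a \<otimes> b)" for a and b :: 'a and t
    by (induction t rule: tensor_induct) (simp_all add: z zr dl dr tens_mult mult.commute)
  show "s * t = t * s"
    by (induction s rule: tensor_induct) (simp_all add: z zr dl dr c1)
  have a1: "(a \<otimes> b) * (a' \<otimes> b') * u = (a \<otimes> b) * ((a' \<otimes> b') * u)" for a a' and b b' :: 'a and u
    by (induction u rule: tensor_induct) (simp_all add: z zr dl dr tens_mult mult.assoc)
  have a2: "(a \<otimes> b) * t * u = (a \<otimes> b) * (t * u)" for a and b :: 'a and t u
    by (induction t rule: tensor_induct) (simp_all add: z zr dl dr a1)
  show "s * t * u = s * (t * u)"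
    by (induction s rule: tensor_induct) (simp_all add: z zr dl dr a2)
  show "1 * t = t"
    by (induction t rule: tensor_induct)
      (simp_all add: z zr dl dr one_dst_tensor_def tens_mult)
  have sc: "m \<bullet> t = (eta_L m \<otimes> 1) * t" for t :: "'a dst_tensor"
    by (induction t rule: tensor_induct)
      (simp_all add: zr dr m2_scale_add_right tens_mult m2_scale_tens)
  show "m \<bullet> (s * t) = (m \<bullet> s) * t"
    by (simp add: sc a2)
  have bal: "balanced (\<lambda>a (b::'a). counit a \<bullet> b)"
    by (simp add: balanced_def ring_mapD[OF counit_ring_map] m2_scale_add_left m2_scale_add_right
        counit_eta_R m2_scale_scale)
  show "(0 :: 'a dst_tensor) \<noteq> 1"
  proof
    assume "(0 :: 'a dst_tensor) = 1"
    then have "1 \<otimes> 1 = (0 :: 'a dst_tensor)" by (simp only: one_dst_tensor_def)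
    then have "tensor_lift (\<lambda>a (b::'a). counit a \<bullet> b) (1 \<otimes> 1) = 0"
      by (simp only: tensor_lift_zero)
    then show False
      by (simp add: tensor_lift_tens[OF bal] ring_mapD[OF counit_ring_map] m2_scale_one)
  qed
qed

end


section \<open>Comultiplication and comodules\<close>

fun comul_gen :: "gen \<Rightarrow> dual_steenrod dst_tensor" where
  "comul_gen (TauVar n) = dtau n \<otimes> 1 + (\<Sum>i\<le>n. (dxi (n - i) ^ (2 ^ i)) \<otimes> dtau i)"
| "comul_gen (XiVar k) = (\<Sum>i\<le>Suc k. (dxi (Suc k - i) ^ (2 ^ i)) \<otimes> dxi i)"

definition comul :: "dual_steenrod \<Rightarrow> dual_steenrod dst_tensor" where
  "comul = dst_lift (poly_eval (\<lambda>m. eta_L m \<otimes> 1) comul_gen)"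

lemma tens_one_ring_map: "ring_map (\<lambda>m. eta_L m \<otimes> (1::'b::m2_algebra))"
  by (simp add: ring_map_def eta_L_simps tens_add_left tens_mult one_dst_tensor_def)

lemma tens_right_eta_L: "1 \<otimes> eta_L m = eta_R m \<otimes> 1"
  using tens_balanced[of 1 m "1::dual_steenrod"] by (simp add: m2_scale_dual_steenrod_def)

lemma tens_split: "a \<otimes> b = (a \<otimes> 1) * (1 \<otimes> (b::'b::m2_algebra))"
  by (simp add: tens_mult)

lemma comul_gen_tau_squared:
  "(comul_gen (TauVar n))\<^sup>2 = (eta_L m2_tau \<otimes> 1) * comul_gen (XiVar n)
     + (eta_L m2_rho \<otimes> 1) * comul_gen (TauVar 0) * comul_gen (XiVar n)
     + (eta_L m2_rho \<otimes> 1) * comul_gen (TauVar (Suc n))"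
proof -
  define T :: "dual_steenrod dst_tensor" where "T = eta_L m2_tau \<otimes> 1"
  define R :: "dual_steenrod dst_tensor" where "R = eta_L m2_rho \<otimes> 1"
  define t :: "dual_steenrod dst_tensor" where "t = dtau 0 \<otimes> 1"
  define u :: "dual_steenrod dst_tensor" where "u = 1 \<otimes> dtau 0"
  define X :: "dual_steenrod dst_tensor" where "X = dxi (Suc n) \<otimes> 1"
  define a where "a i = dxi (n - i) ^ (2 ^ Suc i)" for i
  define S1 where "S1 = (\<Sum>i\<le>n. a i \<otimes> dxi (Suc i))"
  define S2 where "S2 = (\<Sum>i\<le>n. a i \<otimes> dtau (Suc i))"
  have sq: "(b \<otimes> c)\<^sup>2 = (b\<^sup>2) \<otimes> (c\<^sup>2)" for b c :: dual_steenrod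
    by (simp add: power2_eq_square tens_mult)
  have rr: "1 \<otimes> (x * y) = (1 \<otimes> x) * (1 \<otimes> (y::dual_steenrod))" for x y by (simp add: tens_mult)
  have lr: "(x * y) \<otimes> 1 = (x \<otimes> 1) * (y \<otimes> (1::dual_steenrod))" for x y by (simp add: tens_mult)
  have tR: "1 \<otimes> eta_L m2_tau = T + R * t"
    by (simp add: tens_right_eta_L eta_R_tau tens_add_left lr T_def R_def t_def)
  have rR: "1 \<otimes> eta_L m2_rho = R"
    by (simp add: tens_right_eta_L eta_R_rho R_def)
  have ti: "1 \<otimes> ((dtau i)\<^sup>2) = (T + R * t + R * u) * (1 \<otimes> dxi (Suc i)) + R * (1 \<otimes> dtau (Suc i))" for i
    by (simp add: dtau_squared tens_add_right rr tR rR u_def distrib_right del: dxi.simps)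
  have pw: "(dxi (n - i) ^ (2 ^ i))\<^sup>2 = a i" for i
    by (simp add: a_def mult.commute flip: power_mult)
  have "(comul_gen (TauVar n))\<^sup>2 = ((dtau n)\<^sup>2) \<otimes> 1 + (\<Sum>i\<le>n. a i \<otimes> ((dtau i)\<^sup>2))"
    by (simp add: m2_frobenius sq pw)
  also have "(\<Sum>i\<le>n. a i \<otimes> ((dtau i)\<^sup>2))
      = (\<Sum>i\<le>n. (T + R * t + R * u) * (a i \<otimes> dxi (Suc i)) + R * (a i \<otimes> dtau (Suc i)))"
  proof (rule sum.cong[OF refl])
    fix i
    show "a i \<otimes> ((dtau i)\<^sup>2) = (T + R * t + R * u) * (a i \<otimes> dxi (Suc i)) + R * (a i \<otimes> dtau (Suc i))"
      by (subst (1 2 3) tens_split) (simp only: ti distrib_left mult_ac)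
  qed
  also have "\<dots> = (T + R * t + R * u) * S1 + R * S2"
    by (simp only: S1_def S2_def sum.distrib sum_distrib_left)
  also have "((dtau n)\<^sup>2) \<otimes> 1 = T * X + R * t * X + R * (dtau (Suc n) \<otimes> 1)"
    by (simp only: dtau_squared tens_add_left lr T_def R_def t_def X_def)
  finally have 1: "(comul_gen (TauVar n))\<^sup>2 = T * X + R * t * X + R * (dtau (Suc n) \<otimes> 1)
      + ((T + R * t + R * u) * S1 + R * S2)" .
  have xi: "comul_gen (XiVar n) = X + S1"
    by (simp add: sum.atMost_Suc_shift X_def S1_def a_def del: dxi.simps(2) sum.atMost_Suc power_Suc)
  have t0: "comul_gen (TauVar 0) = t + u" by (simp add: t_def u_def)
  have "comul_gen (TauVar (Suc n)) = dtau (Suc n) \<otimes> 1 + (dxi (Suc n) \<otimes> dtau 0 + S2)"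
    by (simp add: sum.atMost_Suc_shift S2_def a_def del: dxi.simps(2) sum.atMost_Suc power_Suc)
  also have "dxi (Suc n) \<otimes> dtau 0 = X * u"
    unfolding X_def u_def by (rule tens_split)
  finally have t1: "comul_gen (TauVar (Suc n)) = dtau (Suc n) \<otimes> 1 + (X * u + S2)" .
  have z: "R * u * X + R * (X * u) = 0"
    using m2_char2[of "R * u * X"] by (simp add: mult_ac)
  have "T * (X + S1) + R * (t + u) * (X + S1) + R * (dtau (Suc n) \<otimes> 1 + (X * u + S2))
    = T * X + R * t * X + R * (dtau (Suc n) \<otimes> 1) + ((T + R * t + R * u) * S1 + R * S2)
      + (R * u * X + R * (X * u))"
    by (simp only: distrib_left distrib_right ac_simps)
  then show ?thesis
    unfolding 1 xi t0 t1 T_def[symmetric] R_def[symmetric] z by simp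
qed

lemma
  shows comul_ring_map: "ring_map comul"
    and comul_eta_L: "comul (eta_L m) = eta_L m \<otimes> 1"
    and comul_dtau: "comul (dtau n) = dtau n \<otimes> 1 + (\<Sum>i\<le>n. (dxi (n - i) ^ (2 ^ i)) \<otimes> dtau i)"
    and comul_dxi: "comul (dxi n) = (\<Sum>i\<le>n. (dxi (n - i) ^ (2 ^ i)) \<otimes> dxi i)"
proof -
  let ?h = "\<lambda>m. eta_L m \<otimes> (1::dual_steenrod)"
  define f where "f = poly_eval ?h comul_gen"
  have f: "ring_map f" unfolding f_def by (rule poly_eval_ring_map[OF tens_one_ring_map])
  have v: "f (pvar v) = comul_gen v" for v
    by (simp add: f_def poly_eval_pvar[OF tens_one_ring_map])
  have c: "f (pconst m) = ?h m" for m
    by (simp add: f_def poly_eval_pconst[OF tens_one_ring_map])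
  have r: "f (dst_rel n) = 0" for n
    by (simp add: dst_rel_def ring_mapD[OF f] ring_map_power[OF f] v c comul_gen_tau_squared
        del: comul_gen.simps)
  note l = dst_lift_class[OF f r]
  have cc: "comul = dst_lift f" by (simp add: comul_def f_def)
  show "ring_map comul" unfolding cc by (rule dst_lift_ring_map[OF f r])
  show "comul (eta_L m) = eta_L m \<otimes> 1" by (simp add: cc eta_L_def l c)
  show "comul (dtau n) = dtau n \<otimes> 1 + (\<Sum>i\<le>n. (dxi (n - i) ^ (2 ^ i)) \<otimes> dtau i)"
    by (simp add: cc dtau_def dst_gen_def l v)
  show "comul (dxi n) = (\<Sum>i\<le>n. (dxi (n - i) ^ (2 ^ i)) \<otimes> dxi i)"
  proof (cases n)
    case 0
    then show ?thesis
      by (simp add: cc ring_mapD(1)[OF dst_lift_ring_map[OF f r]] one_dst_tensor_def tens_mult)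
  next
    case (Suc k)
    have "comul (dxi (Suc k)) = comul_gen (XiVar k)"
      by (simp only: cc dxi.simps dst_gen_def l v)
    then show ?thesis by (simp only: Suc comul_gen.simps)
  qed
qed

lemma comul_eta_R: "comul (eta_R m) = 1 \<otimes> eta_R m"
proof -
  have r: "ring_map (\<lambda>m. comul (eta_R m))"
    using comul_ring_map eta_R_ring_map by (simp add: ring_map_def)
  have r': "ring_map (\<lambda>m. (1::dual_steenrod) \<otimes> eta_R m)"
    by (simp add: ring_map_def eta_R_simps tens_add_right tens_mult one_dst_tensor_def)
  have l: "(1::dual_steenrod) \<otimes> (eta_L a * b) = eta_R a \<otimes> b" for a b
    using tens_balanced[of 1 a b] by (simp add: m2_scale_dual_steenrod_def)
  have "comul (eta_R (pvar v)) = 1 \<otimes> eta_R (pvar v)" for v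
  proof (cases v)
    case TauM
    have "comul (eta_R m2_tau)
        = (eta_L m2_tau + eta_L m2_rho * dtau 0) \<otimes> 1 + eta_L m2_rho \<otimes> dtau 0"
      by (simp add: eta_R_tau ring_mapD[OF comul_ring_map] comul_eta_L comul_dtau tens_add_left
          tens_mult distrib_left ac_simps)
    also have "\<dots> = 1 \<otimes> eta_R m2_tau"
      using l[of m2_tau 1] l[of m2_rho "dtau 0"]
      by (simp add: eta_R_tau eta_R_rho tens_add_right)
    finally show ?thesis using TauM by simp
  next
    case RhoM
    then show ?thesis using l[of m2_rho 1] by (simp add: eta_R_rho comul_eta_L)
  qed
  moreover have "comul (eta_R (pconst b)) = 1 \<otimes> eta_R (pconst b)" for b
    using l[of "pconst b" 1] by (simp add: eta_R_pconst comul_eta_L)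
  ultimately show ?thesis using poly_ring_map_eqI[OF r r'] by blast
qed

definition tensor_assoc ::
  "dual_steenrod dst_tensor \<Rightarrow> 'n::m2_module \<Rightarrow> 'n dst_tensor dst_tensor" where
  "tensor_assoc t x = tensor_lift (\<lambda>a b. a \<otimes> (b \<otimes> x)) t"

definition left_comodule :: "('n::m2_module \<Rightarrow> 'n dst_tensor) \<Rightarrow> bool" where
  "left_comodule \<psi> \<longleftrightarrow>
     (\<forall>x y. \<psi> (x + y) = \<psi> x + \<psi> y) \<and>
     (\<forall>m x. \<psi> (m \<bullet> x) = m \<bullet> \<psi> x) \<and>
     (\<forall>x. tensor_lift (\<lambda>a y. tensor_assoc (comul a) y) (\<psi> x) = tensor_lift (\<lambda>a y. a \<otimes> \<psi> y) (\<psi> x)) \<and>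
     (\<forall>x. tensor_lift (\<lambda>a y. counit a \<bullet> y) (\<psi> x) = x)"

text \<open>The maps lifted in \<open>left_comodule\<close> are balanced.\<close>

lemma balanced_assoc: "balanced (\<lambda>a b. a \<otimes> (b \<otimes> (x::'n::m2_module)))"
  by (simp add: balanced_def tens_add_left tens_add_right tens_balanced m2_scale_tens
      m2_scale_dual_steenrod_def)

lemma tensor_assoc_tens: "tensor_assoc (a \<otimes> b) x = a \<otimes> (b \<otimes> x)"
  by (simp add: tensor_assoc_def tensor_lift_tens[OF balanced_assoc])

lemma balanced_comul: "balanced (\<lambda>a x. tensor_assoc (comul a) (x::'n::m2_module))"
proof -
  have z: "tensor_assoc 0 x = 0" and a: "tensor_assoc (s + t) x = tensor_assoc s x + tensor_assoc t x"
    for s t and x :: 'n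
    by (simp_all add: tensor_assoc_def)
  have "tensor_assoc t (x + y) = tensor_assoc t x + tensor_assoc t y" for t and x y :: 'n
    by (induction t rule: tensor_induct) (simp_all add: z a tensor_assoc_tens tens_add_right ac_simps)
  moreover have "tensor_assoc (t * (1 \<otimes> eta_R m)) x = tensor_assoc t (m \<bullet> x)" for t m and x :: 'n
    by (induction t rule: tensor_induct)
      (simp_all add: z a tensor_assoc_tens distrib_right tens_mult tens_balanced)
  ultimately show ?thesis
    by (simp add: balanced_def z a ring_mapD[OF comul_ring_map] comul_eta_R)
qed

lemma balanced_coaction:
  assumes "\<And>x y. \<psi> (x + y) = \<psi> x + \<psi> y" "\<And>m x. \<psi> (m \<bullet> x) = m \<bullet> \<psi> x"
  shows "balanced (\<lambda>a x. a \<otimes> \<psi> (x::'n::m2_module) :: 'n dst_tensor dst_tensor)"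
  by (simp add: balanced_def assms tens_add_left tens_add_right tens_balanced)

lemma balanced_counit: "balanced (\<lambda>a (x::'n::m2_module). counit a \<bullet> x)"
  by (simp add: balanced_def ring_mapD[OF counit_ring_map] m2_scale_add_left m2_scale_add_right
      counit_eta_R m2_scale_scale)


section \<open>The Steenrod algebra\<close>

fun m2_gen_degree :: "m2_gen \<Rightarrow> int \<times> int" where
  "m2_gen_degree TauM = (0, - 1)"
| "m2_gen_degree RhoM = (- 1, - 1)"

fun gen_degree :: "gen \<Rightarrow> int \<times> int" where
  "gen_degree (TauVar i) = (2 ^ (i + 1) - 1, 2 ^ i - 1)"
| "gen_degree (XiVar k) = (2 ^ (k + 2) - 2, 2 ^ (k + 1) - 1)"

definition monom_degree :: "('v \<Rightarrow> int \<times> int) \<Rightarrow> ('v \<Rightarrow>\<^sub>0 nat) \<Rightarrow> int \<times> int" where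
  "monom_degree d e = (\<Sum>v\<in>Poly_Mapping.keys e.
     (int (Poly_Mapping.lookup e v) * fst (d v), int (Poly_Mapping.lookup e v) * snd (d v)))"

definition m2_homogeneous :: "int \<times> int \<Rightarrow> m2r set" where
  "m2_homogeneous d = {m. \<forall>e\<in>Poly_Mapping.keys m. monom_degree m2_gen_degree e = d}"

definition dst_homogeneous :: "int \<times> int \<Rightarrow> dual_steenrod set" where
  "dst_homogeneous d = {dst_class p | p.
     \<forall>e\<in>Poly_Mapping.keys p. Poly_Mapping.lookup p e \<in> m2_homogeneous (d - monom_degree gen_degree e)}"

definition left_linear :: "(dual_steenrod \<Rightarrow> m2r) \<Rightarrow> bool" where
  "left_linear \<phi> \<longleftrightarrow> (\<forall>a b. \<phi> (a + b) = \<phi> a + \<phi> b) \<and> (\<forall>m a. \<phi> (m \<bullet> a) = m * \<phi> a)"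

definition graded_hom :: "int \<times> int \<Rightarrow> (dual_steenrod \<Rightarrow> m2r) set" where
  "graded_hom d = {\<phi>. left_linear \<phi> \<and> (\<forall>e. \<forall>a\<in>dst_homogeneous e. \<phi> a \<in> m2_homogeneous (e + d))}"

text \<open>Elements of the bigraded \<open>Hom\<close> are the finite sums of homogeneous left-linear maps.\<close>

definition steenrod_algebra :: "(dual_steenrod \<Rightarrow> m2r) set" where
  "steenrod_algebra = {\<lambda>a. \<Sum>d\<in>D. \<phi> d a | D \<phi>. finite D \<and> (\<forall>d\<in>D. \<phi> d \<in> graded_hom d)}"

definition steenrod_mult ::
  "(dual_steenrod \<Rightarrow> m2r) \<Rightarrow> (dual_steenrod \<Rightarrow> m2r) \<Rightarrow> dual_steenrod \<Rightarrow> m2r" where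
  "steenrod_mult \<phi> \<psi> a = tensor_lift (\<lambda>a' a''. \<phi> (a' * eta_R (\<psi> a''))) (comul a)"

definition steenrod_action ::
  "('n::m2_module \<Rightarrow> 'n dst_tensor) \<Rightarrow> (dual_steenrod \<Rightarrow> m2r) \<Rightarrow> 'n \<Rightarrow> 'n" where
  "steenrod_action \<psi> \<phi> n = tensor_lift (\<lambda>a x. \<phi> (dst_conj a) \<bullet> x) (\<psi> n)"

lemma steenrod_algebra_left_linear:
  assumes "\<phi> \<in> steenrod_algebra"
  shows "left_linear \<phi>"
proof -
  from assms obtain D \<phi>' where *: "\<phi> = (\<lambda>a. \<Sum>d\<in>D. \<phi>' d a)" "\<forall>d\<in>D. \<phi>' d \<in> graded_hom d"
    unfolding steenrod_algebra_def by auto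
  from *(2) have "left_linear (\<phi>' d)" if "d \<in> D" for d
    using that by (auto simp: graded_hom_def)
  then show ?thesis
    unfolding *(1)
    by (auto simp: left_linear_def sum_distrib_left simp flip: sum.distrib intro!: sum.cong)
qed

lemma left_linear_zero: "left_linear \<phi> \<Longrightarrow> \<phi> 0 = 0"
  unfolding left_linear_def by (metis m2_scale_zero(1) mult_zero_left)

text \<open>The maps lifted in \<open>steenrod_mult\<close> and \<open>steenrod_action\<close> are balanced.\<close>

lemma balanced_steenrod_mult:
  assumes "left_linear \<phi>" "left_linear \<psi>"
  shows "balanced (\<lambda>a' a''. \<phi> (a' * eta_R (\<psi> a'')))"
  using assms left_linear_zero[OF assms(1)]
  by (simp add: balanced_def left_linear_def distrib_left distrib_right eta_R_simps mult.assoc)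

lemma balanced_steenrod_action:
  assumes "left_linear \<phi>"
  shows "balanced (\<lambda>a (x::'n::m2_module). \<phi> (dst_conj a) \<bullet> x)"
proof -
  have "\<phi> (a * eta_L m) = \<phi> a * m" for a m
    using assms by (simp add: left_linear_def m2_scale_dual_steenrod_def mult.commute)
  then show ?thesis
    using assms left_linear_zero[OF assms]
    by (simp add: balanced_def left_linear_def ring_mapD[OF dst_conj_ring_map] dst_conj_eta_R
        m2_scale_add_left m2_scale_add_right m2_scale_scale)
qed


section \<open>The monomial basis and its dual\<close>

definition basis_index :: "(gen \<Rightarrow>\<^sub>0 nat) set" where
  "basis_index = {e. \<forall>n. Poly_Mapping.lookup e (TauVar n) \<le> 1}"

definition dst_basis :: "(gen \<Rightarrow>\<^sub>0 nat) \<Rightarrow> dual_steenrod" where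
  "dst_basis e = monom_eval dst_gen e"

text \<open>
  \<open>dual_basis i\<close> is the element of \<open>steenrod_algebra\<close> dual to \<open>dst_basis i\<close>: it is unique because
  the monomials span, and exists because they are linearly independent.
\<close>

definition dual_basis :: "(gen \<Rightarrow>\<^sub>0 nat) \<Rightarrow> dual_steenrod \<Rightarrow> m2r" where
  "dual_basis i = (THE \<phi>. \<phi> \<in> steenrod_algebra \<and>
     (\<forall>j\<in>basis_index. \<phi> (dst_basis j) = (if i = j then 1 else 0)))"

end

theory Submission
  imports Defs
begin

text \<open>
  Writing \<open>\<psi> n = \<Sum>k. a\<^sub>k \<otimes> x\<^sub>k\<close>, one expands each \<open>c(a\<^sub>k)\<close> in the monomial basis and applies \<open>c\<close>: since
  \<open>c\<close> is an involution that turns left into right scalars, \<open>a\<^sub>k\<close> is the sum of the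
  \<open>c(b\<^sub>i) \<eta>\<^sub>R(B\<^sup>i(c(a\<^sub>k)))\<close>, and the right scalars move through the tensor sign.  That the monomials
  form a basis is a confluence argument for the rewriting of \<open>\<tau>\<^sub>n\<^sup>2\<close> by the defining relation, which
  lowers the degree in the \<open>\<tau>\<close> generators; as the relations are homogeneous, so are the coordinates.
\<close>

section \<open>The conjugation is an involution\<close>

text \<open>
  \<open>twisted_conv\<close> is the composition of additive power series \<open>\<Sum>i. a i * x ^ 2 ^ i\<close>.  The recursions for the
  conjugates say that \<open>c(\<xi>)\<close> is a left inverse of \<open>\<xi>\<close> and that \<open>\<tau>\<close> is \<open>c(\<tau>)\<close> composed with \<open>\<xi>\<close>.
\<close>

definition twisted_conv :: "(nat \<Rightarrow> 'a::m2_algebra) \<Rightarrow> (nat \<Rightarrow> 'a) \<Rightarrow> nat \<Rightarrow> 'a" where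
  "twisted_conv a b n = (\<Sum>i\<le>n. a i * b (n - i) ^ 2 ^ i)"

lemma m2_frobenius_iterate:
  "(\<Sum>i\<in>A. (f i :: 'a::m2_algebra)) ^ 2 ^ k = (\<Sum>i\<in>A. f i ^ 2 ^ k)"
proof (induction k)
  case (Suc k)
  have "(\<Sum>i\<in>A. f i) ^ 2 ^ Suc k = ((\<Sum>i\<in>A. f i) ^ 2 ^ k) ^ 2"
    by (simp add: mult.commute flip: power_mult)
  also have "\<dots> = (\<Sum>i\<in>A. (f i ^ 2 ^ k) ^ 2)"
    by (simp only: Suc m2_frobenius)
  finally show ?case by (simp add: mult.commute flip: power_mult)
qed simp

text \<open>Iterates of the Frobenius are additive, so \<open>_ ^ 2 ^ i\<close> passes through the
  inner sum; both sides become the sum of \<open>?g i j\<close> over all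
  \<open>i + j \<le> n\<close>.\<close>

lemma twisted_conv_assoc:
  "twisted_conv (twisted_conv a b) c = twisted_conv a (twisted_conv b c)"
proof
  fix n
  let ?g = "\<lambda>i j. a i * b j ^ 2 ^ i * c (n - i - j) ^ 2 ^ (i + j)"
  have "twisted_conv (twisted_conv a b) c n = (\<Sum>k\<le>n. \<Sum>i\<le>k. ?g i (k - i))"
    by (auto simp: twisted_conv_def sum_distrib_right intro!: sum.cong)
  also have "\<dots> = (\<Sum>(i, j)\<in>{(i, j). i + j \<le> n}. ?g i j)"
    by (rule sum.triangle_reindex_eq[symmetric])
  also have "{(i, j). i + j \<le> n} = (SIGMA i:{..n}. {..n - i})" by auto
  also have "(\<Sum>(i, j)\<in>(SIGMA i:{..n}. {..n - i}). ?g i j) = (\<Sum>i\<le>n. \<Sum>j\<le>n - i. ?g i j)"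
    by (simp add: sum.Sigma)
  also have "\<dots> = twisted_conv a (twisted_conv b c) n"
    unfolding twisted_conv_def m2_frobenius_iterate
    by (simp add: sum_distrib_left power_mult_distrib mult.assoc power_add mult.commute
        flip: power_mult)
  finally show "twisted_conv (twisted_conv a b) c n = twisted_conv a (twisted_conv b c) n" .
qed

abbreviation twisted_unit :: "nat \<Rightarrow> 'a::m2_algebra" where
  "twisted_unit n \<equiv> (if n = 0 then 1 else 0)"

lemma twisted_conv_unit_right: "twisted_conv a twisted_unit = a"
proof
  fix n
  have "twisted_conv a twisted_unit n = (\<Sum>i\<le>n. if i = n then a i else 0)"
    unfolding twisted_conv_def by (intro sum.cong) (auto simp: zero_power)
  then show "twisted_conv a twisted_unit n = a n" by simp
qed

lemma twisted_conv_unit_left: "twisted_conv twisted_unit a = a"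
proof
  fix n
  have "twisted_conv twisted_unit a n = (\<Sum>i\<le>n. if i = 0 then a n else 0)"
    unfolding twisted_conv_def by (intro sum.cong) (auto simp: zero_power)
  then show "twisted_conv twisted_unit a n = a n" by simp
qed

text \<open>The term \<open>i = 0\<close> of the composite is \<open>b n\<close> itself, and the
  other terms involve only earlier values of \<open>b\<close>.\<close>

lemma twisted_conv_left_cancel:
  assumes "a 0 = 1" "twisted_conv a b = twisted_conv a b'"
  shows "b = b'"
proof
  fix n
  show "b n = b' n"
  proof (induction n rule: less_induct)
    case (less n)
    have *: "twisted_conv a b n = b n + (\<Sum>i\<in>{1..n}. a i * b (n - i) ^ 2 ^ i)" for b
    proof -
      have "{..n} = insert 0 {1..n}" by auto
      then show ?thesis by (simp add: twisted_conv_def assms(1))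
    qed
    have "(\<Sum>i\<in>{1..n}. a i * b (n - i) ^ 2 ^ i) = (\<Sum>i\<in>{1..n}. a i * b' (n - i) ^ 2 ^ i)"
      using less by (intro sum.cong) auto
    with assms(2) *[of b] *[of b'] show ?case by simp
  qed
qed

text \<open>By associativity, composing \<open>a\<close> with \<open>twisted_conv b a\<close> gives
  \<open>a\<close> back, so the factor \<open>a\<close> on the left can be cancelled.\<close>

lemma twisted_conv_left_inverse_imp_right_inverse:
  assumes "a 0 = 1" "twisted_conv a b = twisted_unit"
  shows "twisted_conv b a = twisted_unit"
  by (rule twisted_conv_left_cancel[where a = a, OF assms(1)])
    (simp only: assms(2) twisted_conv_unit_left twisted_conv_unit_right flip: twisted_conv_assoc)

section \<open>Conjugation as compositional inversion\<close>

lemma conj_xi_left_inverse: "twisted_conv conj_xi dxi = twisted_unit"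
proof
  fix n
  show "twisted_conv conj_xi dxi n = twisted_unit n"
  proof (cases n)
    case (Suc k)
    have "twisted_conv conj_xi dxi n
        = (\<Sum>i\<le>k. dxi (Suc k - i) ^ 2 ^ i * conj_xi i) + conj_xi (Suc k)"
      by (simp add: twisted_conv_def Suc mult.commute del: conj_xi.simps(2))
    \<comment> \<open>By the recursion the sum is \<open>conj_xi (Suc k)\<close>, so it cancels the
      last term in characteristic 2.\<close>
    also have "\<dots> = 0"
      by (simp only: m2_char2 flip: conj_xi.simps(2))
    finally show ?thesis using Suc by simp
  qed (simp add: twisted_conv_def)
qed

lemma conj_xi_right_inverse: "twisted_conv dxi conj_xi = twisted_unit"
  by (rule twisted_conv_left_inverse_imp_right_inverse[OF _ conj_xi_left_inverse]) simp

lemma conj_tau_conv_dxi: "twisted_conv conj_tau dxi = dtau"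
proof
  fix n
  let ?S = "\<Sum>i<n. dxi (n - i) ^ 2 ^ i * conj_tau i"
  have "twisted_conv conj_tau dxi n = ?S + conj_tau n"
    by (simp add: twisted_conv_def mult.commute flip: lessThan_Suc_atMost)
  also have "conj_tau n = dtau n + ?S" by (rule conj_tau.simps)
  also have "?S + (dtau n + ?S) = dtau n" by (simp add: m2_char2 add.left_commute)
  finally show "twisted_conv conj_tau dxi n = dtau n" .
qed

text \<open>Compose \<open>conj_tau_conv_dxi\<close> on the right with \<open>conj_xi\<close>, the
  two-sided inverse of \<open>dxi\<close>.\<close>

lemma dtau_conv_conj_xi: "twisted_conv dtau conj_xi = conj_tau"
  by (simp only: conj_xi_right_inverse twisted_conv_unit_right twisted_conv_assoc
      flip: conj_tau_conv_dxi)

text \<open>Right cancellation at a single index: \<open>b 0 = 1\<close> leaves \<open>h n\<close>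
  alone in the last term, and the earlier terms agree.\<close>

lemma twisted_conv_fixed:
  assumes "\<And>i. i < n \<Longrightarrow> h i = a i" "twisted_conv h b n = twisted_conv a b n" "b 0 = 1"
  shows "h n = a n"
proof -
  have *: "twisted_conv f b n = (\<Sum>i<n. f i * b (n - i) ^ 2 ^ i) + f n" for f
    using assms(3) by (simp add: twisted_conv_def flip: lessThan_Suc_atMost)
  show ?thesis using assms(1,2) by (simp add: *)
qed

lemma dst_conj_twisted_conv:
  "dst_conj (twisted_conv a b n) = twisted_conv (\<lambda>i. dst_conj (a i)) (\<lambda>i. dst_conj (b i)) n"
  by (simp add: twisted_conv_def ring_map_sum[OF dst_conj_ring_map]
      ring_mapD(3)[OF dst_conj_ring_map] ring_map_power[OF dst_conj_ring_map])

lemma dst_conj_conj_xi: "dst_conj (conj_xi n) = dxi n"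
proof (induction n rule: less_induct)
  case (less n)
  \<comment> \<open>Applying \<open>dst_conj\<close> to \<open>conj_xi_left_inverse\<close> turns
    \<open>dxi\<close> into \<open>conj_xi\<close>; both sides are then the unit series.\<close>
  have "twisted_conv (\<lambda>i. dst_conj (conj_xi i)) conj_xi n = twisted_conv dxi conj_xi n"
    using dst_conj_twisted_conv[of conj_xi dxi n]
    by (simp add: conj_xi_left_inverse conj_xi_right_inverse dst_conj_dxi
        ring_mapD[OF dst_conj_ring_map] split: if_splits del: conj_xi.simps)
  with less show ?case
    by (rule twisted_conv_fixed[where h = "\<lambda>i. dst_conj (conj_xi i)" and a = dxi]) simp_all
qed

lemma dst_conj_conj_tau: "dst_conj (conj_tau n) = dtau n"
proof (induction n rule: less_induct)
  case (less n)
  \<comment> \<open>This is the conjugate of \<open>conj_tau_conv_dxi\<close>; both sides are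
    \<open>conj_tau n\<close>.\<close>
  have "twisted_conv (\<lambda>i. dst_conj (conj_tau i)) conj_xi n = twisted_conv dtau conj_xi n"
    using dst_conj_twisted_conv[of conj_tau dxi n]
    by (simp add: conj_tau_conv_dxi dtau_conv_conj_xi dst_conj_dxi dst_conj_dtau del: conj_xi.simps)
  with less show ?case
    by (rule twisted_conv_fixed[where h = "\<lambda>i. dst_conj (conj_tau i)" and a = dtau]) simp_all
qed

lemma dst_conj_dst_conj: "dst_conj (dst_conj a) = a"
proof (rule dual_steenrod_ring_map_eqI[of "\<lambda>a. dst_conj (dst_conj a)" "\<lambda>a. a"])
  show "ring_map (\<lambda>a. dst_conj (dst_conj a))" "ring_map (\<lambda>a::dual_steenrod. a)"
    using dst_conj_ring_map by (simp_all add: ring_map_def)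
qed (simp_all only: dst_conj_eta_L dst_conj_eta_R dst_conj_dtau dst_conj_dxi dst_conj_conj_tau
    dst_conj_conj_xi)


section \<open>Degrees of monomials\<close>

text \<open>Serves both \<open>monom_degree\<close> and \<open>tau_degree\<close>, whose weights are
  additive in the exponent.\<close>

lemma sum_keys_add:
  fixes w :: "'v \<Rightarrow> nat \<Rightarrow> 'b::comm_monoid_add"
  assumes "\<And>v. w v 0 = 0" "\<And>v m n. w v (m + n) = w v m + w v n"
  shows "(\<Sum>v\<in>Poly_Mapping.keys (e + e'). w v (Poly_Mapping.lookup (e + e') v))
    = (\<Sum>v\<in>Poly_Mapping.keys e. w v (Poly_Mapping.lookup e v))
      + (\<Sum>v\<in>Poly_Mapping.keys e'. w v (Poly_Mapping.lookup e' v))"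
proof -
  let ?S = "Poly_Mapping.keys e \<union> Poly_Mapping.keys e'"
  have *: "(\<Sum>v\<in>Poly_Mapping.keys f. w v (Poly_Mapping.lookup f v))
      = (\<Sum>v\<in>?S. w v (Poly_Mapping.lookup f v))" if "Poly_Mapping.keys f \<subseteq> ?S" for f
    using that assms(1) by (intro sum.mono_neutral_left) (auto simp: in_keys_iff)
  show ?thesis
    unfolding *[OF Poly_Mapping.keys_add] *[OF Un_upper1] *[OF Un_upper2]
    by (simp add: lookup_add assms(2) sum.distrib)
qed

lemma monom_degree_add: "monom_degree d (e + e') = monom_degree d e + monom_degree d e'"
  unfolding monom_degree_def
  by (rule sum_keys_add[of "\<lambda>v n. (int n * fst (d v), int n * snd (d v))"])
    (simp_all add: zero_prod_def algebra_simps)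

lemma monom_degree_zero: "monom_degree d 0 = 0"
  by (simp add: monom_degree_def)

lemma monom_degree_single:
  "monom_degree d (Poly_Mapping.single v n) = (int n * fst (d v), int n * snd (d v))"
  by (simp add: monom_degree_def zero_prod_def)

lemma m2_homogeneous_zero: "0 \<in> m2_homogeneous d"
  by (simp add: m2_homogeneous_def)

lemma m2_homogeneous_one: "1 \<in> m2_homogeneous 0"
  by (simp add: m2_homogeneous_def monom_degree_zero)

lemma m2_homogeneous_add:
  "x \<in> m2_homogeneous d \<Longrightarrow> y \<in> m2_homogeneous d \<Longrightarrow> x + y \<in> m2_homogeneous d"
  using Poly_Mapping.keys_add[of x y] by (auto simp: m2_homogeneous_def)

lemma m2_homogeneous_sum:
  "(\<And>i. i \<in> A \<Longrightarrow> f i \<in> m2_homogeneous d) \<Longrightarrow> sum f A \<in> m2_homogeneous d"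
  by (induction A rule: infinite_finite_induct) (auto intro: m2_homogeneous_zero m2_homogeneous_add)

lemma m2_homogeneous_mult:
  assumes "x \<in> m2_homogeneous d" "y \<in> m2_homogeneous d'"
  shows "x * y \<in> m2_homogeneous (d + d')"
  using Poly_Mapping.keys_mult[of x y] assms by (fastforce simp: m2_homogeneous_def monom_degree_add)

lemma m2_homogeneous_pvar: "pvar v \<in> m2_homogeneous (m2_gen_degree v)"
  by (simp add: m2_homogeneous_def pvar_def monom_degree_single)

text \<open>The measure for the rewriting: the square of a \<tau> generator counts 2, whereas each
  monomial replacing it counts at most 1.\<close>

definition tau_degree :: "(gen \<Rightarrow>\<^sub>0 nat) \<Rightarrow> nat" where
  "tau_degree e = (\<Sum>v\<in>Poly_Mapping.keys e.
     case v of TauVar _ \<Rightarrow> Poly_Mapping.lookup e v | XiVar _ \<Rightarrow> 0)"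

lemma tau_degree_add: "tau_degree (e + e') = tau_degree e + tau_degree e'"
  unfolding tau_degree_def
  by (rule sum_keys_add[of "\<lambda>v n. case v of TauVar _ \<Rightarrow> n | XiVar _ \<Rightarrow> 0"])
    (simp_all split: gen.split)

lemma tau_degree_single:
  "tau_degree (Poly_Mapping.single (TauVar n) k) = k"
  "tau_degree (Poly_Mapping.single (XiVar n) k) = 0"
  by (simp_all add: tau_degree_def)


section \<open>Coordinates in the monomial basis\<close>

abbreviation tau_exp :: "nat \<Rightarrow> nat \<Rightarrow> (gen \<Rightarrow>\<^sub>0 nat)" where
  "tau_exp n k \<equiv> Poly_Mapping.single (TauVar n) k"

abbreviation xi_exp :: "nat \<Rightarrow> (gen \<Rightarrow>\<^sub>0 nat)" where
  "xi_exp n \<equiv> Poly_Mapping.single (XiVar n) 1"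

text \<open>The value on \<open>e * \<tau>\<^sub>n\<^sup>2\<close> that the \<open>n\<close>-th relation prescribes for a linear extension of \<open>f\<close>.\<close>

definition tau_reduct :: "((gen \<Rightarrow>\<^sub>0 nat) \<Rightarrow> m2r) \<Rightarrow> nat \<Rightarrow> (gen \<Rightarrow>\<^sub>0 nat) \<Rightarrow> m2r" where
  "tau_reduct f n e = m2_tau * f (e + xi_exp n) + m2_rho * f (e + (tau_exp 0 1 + xi_exp n))
     + m2_rho * f (e + tau_exp (Suc n) 1)"

text \<open>An arbitrary choice where several squares are present; \<open>dst_coeff_square\<close>
  shows that the coordinates do not depend on it.\<close>

definition square_index :: "(gen \<Rightarrow>\<^sub>0 nat) \<Rightarrow> nat" where
  "square_index e = (SOME n. 2 \<le> Poly_Mapping.lookup e (TauVar n))"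

definition square_cofactor :: "(gen \<Rightarrow>\<^sub>0 nat) \<Rightarrow> (gen \<Rightarrow>\<^sub>0 nat)" where
  "square_cofactor e = e - tau_exp (square_index e) 2"

lemma tau_exp_cofactor:
  assumes "k \<le> Poly_Mapping.lookup e (TauVar n)"
  shows "e = (e - tau_exp n k) + tau_exp n k"
  using assms by (intro poly_mapping_eqI) (auto simp: lookup_add lookup_minus lookup_single when_def)

lemma square_cofactor:
  assumes "e \<notin> basis_index"
  shows "e = square_cofactor e + tau_exp (square_index e) 2"
proof -
  have "\<exists>n. 2 \<le> Poly_Mapping.lookup e (TauVar n)"
    using assms by (auto simp: basis_index_def not_le Suc_le_eq numeral_2_eq_2)
  then have "2 \<le> Poly_Mapping.lookup e (TauVar (square_index e))"
    unfolding square_index_def by (rule someI_ex)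
  then show ?thesis unfolding square_cofactor_def by (rule tau_exp_cofactor)
qed

lemma tau_degree_square_cofactor:
  assumes "e \<notin> basis_index"
  shows "tau_degree e = tau_degree (square_cofactor e) + 2"
  by (subst square_cofactor[OF assms]) (simp only: tau_degree_add tau_degree_single)

text \<open>The coefficient of the basis monomial \<open>i\<close> in the normal form of the
  monomial \<open>e\<close>. The last branch is \<open>tau_reduct\<close> written out, so that the
  recursive arguments are explicit.\<close>

function dst_coeff :: "(gen \<Rightarrow>\<^sub>0 nat) \<Rightarrow> (gen \<Rightarrow>\<^sub>0 nat) \<Rightarrow> m2r" where
  "dst_coeff i e = (if e \<in> basis_index then (if i = e then 1 else 0)
     else m2_tau * dst_coeff i (square_cofactor e + xi_exp (square_index e))
       + m2_rho * dst_coeff i (square_cofactor e + (tau_exp 0 1 + xi_exp (square_index e)))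
       + m2_rho * dst_coeff i (square_cofactor e + tau_exp (Suc (square_index e)) 1))"
  by auto
termination
  by (relation "measure (\<lambda>(i, e). tau_degree e)")
    (simp_all add: tau_degree_square_cofactor tau_degree_add tau_degree_single)

declare dst_coeff.simps [simp del]

lemma dst_coeff_basis: "e \<in> basis_index \<Longrightarrow> dst_coeff i e = (if i = e then 1 else 0)"
  by (simp add: dst_coeff.simps)

lemma dst_coeff_nonbasis:
  "e \<notin> basis_index \<Longrightarrow> dst_coeff i e = tau_reduct (dst_coeff i) (square_index e) (square_cofactor e)"
  by (subst dst_coeff.simps) (simp add: tau_reduct_def)

text \<open>Confluence: two different squares in a monomial do not overlap, and rewriting both of
  them gives the same nine terms in either order. The induction hypothesis permits rewriting the
  second square, whose cofactor is smaller.\<close>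

lemma dst_coeff_square: "dst_coeff i (e + tau_exp n 2) = tau_reduct (dst_coeff i) n e"
proof (induction "tau_degree e" arbitrary: e n rule: less_induct)
  case less
  let ?e = "e + tau_exp n 2"
  define m where "m = square_index ?e"
  define e' where "e' = square_cofactor ?e"
  have "\<not> Poly_Mapping.lookup ?e (TauVar n) \<le> 1" by (simp add: lookup_add)
  then have nb: "?e \<notin> basis_index" unfolding basis_index_def by blast
  have e': "?e = e' + tau_exp m 2"
    unfolding e'_def m_def by (rule square_cofactor[OF nb])
  have red: "dst_coeff i ?e = tau_reduct (dst_coeff i) m e'"
    unfolding e'_def m_def by (rule dst_coeff_nonbasis[OF nb])
  show ?case
  proof (cases "m = n")
    case True
    then have "e = e'" using e' by simp
    then show ?thesis using red True by simp
  next
    case False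
    \<comment> \<open>What remains of \<open>?e\<close> when both squares are removed.\<close>
    define d where "d = e - tau_exp m 2"
    have "Poly_Mapping.lookup e (TauVar m) = Poly_Mapping.lookup ?e (TauVar m)"
      using False by (simp add: lookup_add lookup_single)
    also have "\<dots> \<ge> 2" unfolding e' by (simp add: lookup_add)
    finally have e: "e = d + tau_exp m 2"
      unfolding d_def by (rule tau_exp_cofactor)
    have "e' + tau_exp m 2 = (d + tau_exp n 2) + tau_exp m 2"
      using e' unfolding e by (simp add: ac_simps)
    then have d: "e' = d + tau_exp n 2" by simp
    \<comment> \<open>\<open>e\<close> exceeds \<open>d\<close> by 2 in \<open>tau_degree\<close>,
      so \<open>d + x\<close> is still smaller than \<open>e\<close>.\<close>
    have IH: "dst_coeff i (d + x + tau_exp k 2) = tau_reduct (dst_coeff i) k (d + x)"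
      if "tau_degree x < 2" for x k
      using that by (intro less) (simp add: e tau_degree_add tau_degree_single)
    have small: "tau_degree (xi_exp k) < 2" "tau_degree (tau_exp 0 1 + xi_exp k) < 2"
      "tau_degree (tau_exp k 1) < 2" for k
      by (simp_all add: tau_degree_add tau_degree_single)
    have swap: "d + tau_exp k 2 + x = d + x + tau_exp k 2" for k x by (simp add: ac_simps)
    have "tau_reduct (dst_coeff i) m (d + tau_exp n 2) = tau_reduct (dst_coeff i) n (d + tau_exp m 2)"
      unfolding tau_reduct_def[of _ m "d + tau_exp n 2"] tau_reduct_def[of _ n "d + tau_exp m 2"] swap
        IH[OF small(1)] IH[OF small(2)] IH[OF small(3)] tau_reduct_def
      by (simp add: algebra_simps)
    then show ?thesis using red unfolding d e[symmetric] by simp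
  qed
qed

section \<open>Homogeneity of the coordinates\<close>

lemma tau_reduct_homogeneous:
  assumes "\<And>x. tau_degree x \<le> 1 \<Longrightarrow> f (e + x) \<in> m2_homogeneous (monom_degree gen_degree (e + x) - d)"
  shows "tau_reduct f n e \<in> m2_homogeneous (monom_degree gen_degree (e + tau_exp n 2) - d)"
proof -
  have *: "pvar v * f (e + x) \<in> m2_homogeneous (monom_degree gen_degree (e + tau_exp n 2) - d)"
    if "tau_degree x \<le> 1"
      "m2_gen_degree v + monom_degree gen_degree x = monom_degree gen_degree (tau_exp n 2)" for v x
  proof -
    have "m2_gen_degree v + (monom_degree gen_degree (e + x) - d)
        = monom_degree gen_degree e + (m2_gen_degree v + monom_degree gen_degree x) - d"
      by (simp add: monom_degree_add algebra_simps)
    also have "\<dots> = monom_degree gen_degree (e + tau_exp n 2) - d"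
      by (simp only: that(2) monom_degree_add)
    finally show ?thesis
      using m2_homogeneous_mult[OF m2_homogeneous_pvar[of v] assms[OF that(1)]] by (simp only:)
  qed
  \<comment> \<open>The three bidegree checks say that the defining relation is homogeneous.\<close>
  show ?thesis
    unfolding tau_reduct_def
    by (intro m2_homogeneous_add *)
      (simp_all add: tau_degree_add tau_degree_single monom_degree_add monom_degree_single)
qed

text \<open>Rewriting preserves the bidegree; this is what puts the coordinate maps into the
  bigraded Hom.\<close>

lemma dst_coeff_homogeneous:
  "dst_coeff i e \<in> m2_homogeneous (monom_degree gen_degree e - monom_degree gen_degree i)"
proof (induction "tau_degree e" arbitrary: e rule: less_induct)
  case less
  show ?case
  proof (cases "e \<in> basis_index")
    case True
    then show ?thesis
      by (simp add: dst_coeff_basis m2_homogeneous_zero m2_homogeneous_one)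
  next
    case False
    \<comment> \<open>Only arguments \<open>square_cofactor e + x\<close> with
      \<open>tau_degree x \<le> 1\<close> occur, and these are smaller than
      \<open>e\<close>.\<close>
    have "tau_reduct (dst_coeff i) (square_index e) (square_cofactor e)
      \<in> m2_homogeneous (monom_degree gen_degree (square_cofactor e + tau_exp (square_index e) 2)
          - monom_degree gen_degree i)"
      by (intro tau_reduct_homogeneous less)
        (simp add: tau_degree_square_cofactor[OF False] tau_degree_add)
    then show ?thesis
      by (simp only: dst_coeff_nonbasis[OF False] flip: square_cofactor[OF False])
  qed
qed

section \<open>Linear coordinates on the quotient ring\<close>

definition linear_ext :: "('k \<Rightarrow> 'r::comm_ring_1) \<Rightarrow> ('k \<Rightarrow>\<^sub>0 'r) \<Rightarrow> 'r" where
  "linear_ext f p = (\<Sum>e\<in>Poly_Mapping.keys p. Poly_Mapping.lookup p e * f e)"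

lemma linear_ext_zero [simp]: "linear_ext f 0 = 0"
  by (simp add: linear_ext_def)

lemma linear_ext_single: "linear_ext f (Poly_Mapping.single e c) = c * f e"
  by (simp add: linear_ext_def)

lemma linear_ext_add: "linear_ext f (p + q) = linear_ext f p + linear_ext f q"
proof -
  let ?S = "Poly_Mapping.keys p \<union> Poly_Mapping.keys q"
  have *: "linear_ext f r = (\<Sum>e\<in>?S. Poly_Mapping.lookup r e * f e)"
    if "Poly_Mapping.keys r \<subseteq> ?S" for r
    using that unfolding linear_ext_def
    by (intro sum.mono_neutral_left) (auto simp: in_keys_iff)
  show ?thesis
    using Poly_Mapping.keys_add[of p q] by (simp add: * lookup_add distrib_right sum.distrib)
qed

lemma linear_ext_diff: "linear_ext f (p - q) = linear_ext f p - linear_ext f q"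
  using linear_ext_add[of f "p - q" q] by simp

lemma linear_ext_pconst_mult:
  fixes p :: "('v \<Rightarrow>\<^sub>0 nat) \<Rightarrow>\<^sub>0 'c::comm_ring_1"
  shows "linear_ext f (pconst c * p) = c * linear_ext f p"
  by (induction p rule: poly_mapping_add_induct)
    (simp_all add: linear_ext_add linear_ext_single pconst_def mult_single algebra_simps)

lemma dst_rel_eq:
  "dst_rel n = Poly_Mapping.single (tau_exp n 2) 1
     - (Poly_Mapping.single (xi_exp n) m2_tau + Poly_Mapping.single (tau_exp 0 1 + xi_exp n) m2_rho
        + Poly_Mapping.single (tau_exp (Suc n) 1) m2_rho)"
  by (simp add: dst_rel_def power2_eq_square pvar_def[of "TauVar _"] pvar_def[of "XiVar _"] pconst_def
      mult_single numeral_2_eq_2 flip: single_add)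

text \<open>On a monomial multiple of a relation the value is a scalar times the difference of the
  two sides of \<open>dst_coeff_square\<close>.\<close>

lemma linear_ext_dst_coeff_rel: "linear_ext (dst_coeff i) (q * dst_rel n) = 0"
proof (induction q rule: poly_mapping_add_induct)
  case (add e c q)
  have "linear_ext (dst_coeff i) (Poly_Mapping.single e c * dst_rel n)
    = c * (dst_coeff i (e + tau_exp n 2) - tau_reduct (dst_coeff i) n e)"
    by (simp add: dst_rel_eq tau_reduct_def distrib_left right_diff_distrib mult_single
        linear_ext_add linear_ext_diff linear_ext_single mult.assoc)
  then show ?case using add by (simp add: distrib_right linear_ext_add dst_coeff_square)
qed simp

lemma linear_ext_dst_coeff_ideal: "p \<in> dst_ideal \<Longrightarrow> linear_ext (dst_coeff i) p = 0"
  by (induction p rule: dst_ideal.induct) (simp_all add: linear_ext_add linear_ext_dst_coeff_rel)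

text \<open>Coordinates are linear but not multiplicative, hence \<open>linear_ext\<close> in place
  of \<open>poly_eval\<close>. As \<open>dst_lift_class\<close> speaks of ring maps, independence of
  the representative is derived from \<open>linear_ext_dst_coeff_ideal\<close>.\<close>

definition dst_coord :: "(gen \<Rightarrow>\<^sub>0 nat) \<Rightarrow> dual_steenrod \<Rightarrow> m2r" where
  "dst_coord i = dst_lift (linear_ext (dst_coeff i))"

lemma dst_coord_class: "dst_coord i (dst_class p) = linear_ext (dst_coeff i) p"
proof -
  have "dst_rep (dst_class p) - p \<in> dst_ideal"
    using dst_class_rep[of "dst_class p"] by (simp add: dual_steenrod.abs_eq_iff)
  then have "linear_ext (dst_coeff i) (dst_rep (dst_class p) - p) = 0"
    by (rule linear_ext_dst_coeff_ideal)
  then show ?thesis by (simp add: dst_coord_def dst_lift_def linear_ext_diff)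
qed

lemma dst_coord_left_linear: "left_linear (dst_coord i)"
proof -
  have "dst_coord i (a + b) = dst_coord i a + dst_coord i b" for a b
    using dst_coord_class[of i "dst_rep a + dst_rep b"] dst_coord_class[of i "dst_rep a"]
      dst_coord_class[of i "dst_rep b"]
    by (simp add: ring_mapD[OF dst_class_ring_map] dst_class_rep linear_ext_add)
  moreover have "dst_coord i (m \<bullet> a) = m * dst_coord i a" for m a
    using dst_coord_class[of i "pconst m * dst_rep a"] dst_coord_class[of i "dst_rep a"]
    by (simp add: ring_mapD[OF dst_class_ring_map] dst_class_rep linear_ext_pconst_mult
        m2_scale_dual_steenrod_def eta_L_def)
  ultimately show ?thesis by (simp add: left_linear_def)
qed

lemma dst_class_monom: "dst_class (Poly_Mapping.single e c) = c \<bullet> dst_basis e"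
proof -
  have p: "ring_map (poly_eval eta_L dst_gen)" by (rule poly_eval_ring_map[OF eta_L_ring_map])
  \<comment> \<open>The quotient map is evaluation at the generators, since ring maps on polynomials
    are determined by constants and variables.\<close>
  have "poly_eval eta_L dst_gen q = dst_class q" for q
    by (rule poly_ring_map_eqI[OF p dst_class_ring_map])
      (simp_all add: poly_eval_pconst[OF eta_L_ring_map] poly_eval_pvar[OF eta_L_ring_map]
        eta_L_def dst_gen_def)
  then have "dst_class (Poly_Mapping.single e c) = poly_eval eta_L dst_gen (Poly_Mapping.single e c)"
    by simp
  then show ?thesis
    by (simp add: poly_eval_single[OF eta_L_ring_map] m2_scale_dual_steenrod_def dst_basis_def)
qed

text \<open>Yields the linear independence of the monomials and, with
  \<open>dst_coord_steenrod_algebra\<close>, the existence of the dual basis.\<close>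

lemma dst_coord_basis:
  assumes "j \<in> basis_index"
  shows "dst_coord i (dst_basis j) = (if i = j then 1 else 0)"
  using dst_coord_class[of i "Poly_Mapping.single j 1"] assms
  by (simp add: dst_class_monom m2_scale_one linear_ext_single dst_coeff_basis)

lemma dst_coord_steenrod_algebra: "dst_coord i \<in> steenrod_algebra"
proof -
  \<comment> \<open>For \<open>i\<close> in \<open>basis_index\<close> the map sends the monomial
    \<open>i\<close> to 1, which has bidegree 0.\<close>
  let ?d = "- monom_degree gen_degree i"
  have "dst_coord i a \<in> m2_homogeneous (d + ?d)" if a: "a \<in> dst_homogeneous d" for d a
  proof -
    from a obtain p where p: "a = dst_class p"
      "\<And>e. e \<in> Poly_Mapping.keys p \<Longrightarrow>
        Poly_Mapping.lookup p e \<in> m2_homogeneous (d - monom_degree gen_degree e)"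
      unfolding dst_homogeneous_def by blast
    have "Poly_Mapping.lookup p e * dst_coeff i e \<in> m2_homogeneous (d + ?d)"
      if "e \<in> Poly_Mapping.keys p" for e
      using m2_homogeneous_mult[OF p(2)[OF that] dst_coeff_homogeneous[of i e]] by simp
    then show ?thesis
      unfolding p(1) dst_coord_class linear_ext_def by (rule m2_homogeneous_sum)
  qed
  then have "dst_coord i \<in> graded_hom ?d"
    by (simp add: graded_hom_def dst_coord_left_linear)
  then show ?thesis
    unfolding steenrod_algebra_def
    by (intro CollectI exI[of _ "{?d}"] exI[of _ "\<lambda>_. dst_coord i"]) simp
qed


section \<open>The monomials span\<close>

inductive_set dst_span :: "dual_steenrod set" where
  dst_span_zero: "0 \<in> dst_span"
| dst_span_add_scale: "j \<in> basis_index \<Longrightarrow> a \<in> dst_span \<Longrightarrow> m \<bullet> dst_basis j + a \<in> dst_span"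

lemma dst_span_add:
  assumes "a \<in> dst_span" "b \<in> dst_span"
  shows "a + b \<in> dst_span"
  using assms by (induction a rule: dst_span.induct) (auto simp: add.assoc intro: dst_span.intros)

lemma dst_span_scale: "a \<in> dst_span \<Longrightarrow> m \<bullet> a \<in> dst_span"
  by (induction a rule: dst_span.induct)
    (auto simp: m2_scale_add_right m2_scale_scale intro: dst_span.intros)

text \<open>The defining relation times a monomial; \<open>dst_basis\<close> denotes the monomial
  for exponents outside \<open>basis_index\<close> as well.\<close>

lemma dst_basis_square:
  "dst_basis (e + tau_exp n 2) = m2_tau \<bullet> dst_basis (e + xi_exp n)
     + m2_rho \<bullet> dst_basis (e + (tau_exp 0 1 + xi_exp n)) + m2_rho \<bullet> dst_basis (e + tau_exp (Suc n) 1)"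
proof -
  have t: "dst_basis (e + tau_exp k l) = dst_basis e * dtau k ^ l" for e k l
    by (cases "l = 0") (simp_all add: dst_basis_def monom_eval_add monom_eval_def[of _ "tau_exp k l"] dtau_def)
  have x: "dst_basis (e + xi_exp k) = dst_basis e * dxi (Suc k)" for e k
    by (simp add: dst_basis_def monom_eval_add monom_eval_def[of _ "xi_exp k"] del: One_nat_def)
  show ?thesis
    unfolding add.assoc[symmetric] t x
    by (simp add: dtau_squared m2_scale_dual_steenrod_def algebra_simps del: dxi.simps)
qed

text \<open>The same rewriting as in \<open>dst_coeff\<close>, with the same measure.\<close>

lemma dst_basis_in_span: "dst_basis e \<in> dst_span"
proof (induction "tau_degree e" arbitrary: e rule: less_induct)
  case less
  show ?case
  proof (cases "e \<in> basis_index")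
    case True
    then show ?thesis
      using dst_span_add_scale[OF True dst_span_zero, of 1] by (simp add: m2_scale_one)
  next
    case False
    have "dst_basis (square_cofactor e + tau_exp (square_index e) 2) \<in> dst_span"
      unfolding dst_basis_square
      by (intro dst_span_add dst_span_scale less)
        (simp_all add: tau_degree_square_cofactor[OF False] tau_degree_add tau_degree_single)
    then show ?thesis by (simp only: flip: square_cofactor[OF False])
  qed
qed

lemma dst_span_UNIV: "a \<in> dst_span"
proof -
  have "dst_class p \<in> dst_span" for p
  proof (induction p rule: poly_mapping_add_induct)
    case zero
    show ?case by (simp add: ring_mapD[OF dst_class_ring_map] dst_span_zero)
  next
    case (add e c p)
    then show ?case
      by (simp add: ring_mapD[OF dst_class_ring_map] dst_class_monom dst_span_add dst_span_scale
          dst_basis_in_span)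
  qed
  from this[of "dst_rep a"] show ?thesis by (simp add: dst_class_rep)
qed

section \<open>Uniqueness of the dual basis\<close>

lemma left_linear_eqI:
  assumes "left_linear \<phi>" "left_linear \<phi>'" "\<And>j. j \<in> basis_index \<Longrightarrow> \<phi> (dst_basis j) = \<phi>' (dst_basis j)"
  shows "\<phi> = \<phi>'"
proof
  fix a
  show "\<phi> a = \<phi>' a"
    using dst_span_UNIV[of a]
    by induction
      (use assms in \<open>simp_all add: left_linear_zero left_linear_def\<close>)
qed

text \<open>Rewriting supplies the existence, and spanning the uniqueness, that the definite
  description asks for.\<close>

lemma dual_basis_eq: "i \<in> basis_index \<Longrightarrow> dual_basis i = dst_coord i"
  unfolding dual_basis_def
  by (rule the_equality)
    (auto simp: dst_coord_steenrod_algebra dst_coord_basis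
      intro!: left_linear_eqI steenrod_algebra_left_linear dst_coord_left_linear)

section \<open>Sums over finite supports\<close>

lemma sum_support_superset:
  assumes "finite S" "{i \<in> A. h i \<noteq> 0} \<subseteq> S" "S \<subseteq> A" "\<And>i. h i = 0 \<Longrightarrow> g i = 0"
  shows "(\<Sum>i | i \<in> A \<and> h i \<noteq> 0. g i) = sum g S"
  using assms by (intro sum.mono_neutral_left) auto

text \<open>Cancellation can shrink the support of the pointwise sum, so all three sums are first
  extended by zeros to the union of the supports. This is the induction step for expanding ring
  elements and for expanding tensors.\<close>

lemma finite_support_sum_add:
  fixes h h' :: "'i \<Rightarrow> 'm::monoid_add" and g :: "'i \<Rightarrow> 'm \<Rightarrow> 'b::comm_monoid_add"
  assumes "finite {i \<in> A. h i \<noteq> 0}" "finite {i \<in> A. h' i \<noteq> 0}"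
    and "\<And>i. g i 0 = 0" "\<And>i x y. g i (x + y) = g i x + g i y"
  shows "finite {i \<in> A. h i + h' i \<noteq> 0}"
    and "(\<Sum>i | i \<in> A \<and> h i + h' i \<noteq> 0. g i (h i + h' i))
      = (\<Sum>i | i \<in> A \<and> h i \<noteq> 0. g i (h i)) + (\<Sum>i | i \<in> A \<and> h' i \<noteq> 0. g i (h' i))"
proof -
  let ?S = "{i \<in> A. h i \<noteq> 0} \<union> {i \<in> A. h' i \<noteq> 0}"
  have S: "finite ?S" "{i \<in> A. h i + h' i \<noteq> 0} \<subseteq> ?S" using assms(1,2) by auto
  then show "finite {i \<in> A. h i + h' i \<noteq> 0}" by (rule rev_finite_subset)
  have *: "(\<Sum>i | i \<in> A \<and> f i \<noteq> 0. g i (f i)) = (\<Sum>i\<in>?S. g i (f i))"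
    if "{i \<in> A. f i \<noteq> 0} \<subseteq> ?S" for f
    by (rule sum_support_superset[OF S(1) that]) (auto simp: assms(3))
  show "(\<Sum>i | i \<in> A \<and> h i + h' i \<noteq> 0. g i (h i + h' i))
      = (\<Sum>i | i \<in> A \<and> h i \<noteq> 0. g i (h i)) + (\<Sum>i | i \<in> A \<and> h' i \<noteq> 0. g i (h' i))"
    using *[of "\<lambda>i. h i + h' i"] *[of h] *[of h'] S(2) by (simp add: assms(4) sum.distrib)
qed

lemma
  shows finite_dst_coord: "finite {i \<in> basis_index. dst_coord i a \<noteq> 0}"
    and dst_coord_expansion:
      "a = (\<Sum>i | i \<in> basis_index \<and> dst_coord i a \<noteq> 0. dst_coord i a \<bullet> dst_basis i)"
proof -
  \<comment> \<open>Finiteness is carried along because adding two expansions requires finite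
    supports.\<close>
  have "finite {i \<in> basis_index. dst_coord i a \<noteq> 0} \<and>
      (\<Sum>i | i \<in> basis_index \<and> dst_coord i a \<noteq> 0. dst_coord i a \<bullet> dst_basis i) = a"
    using dst_span_UNIV[of a]
  proof induction
    case dst_span_zero
    show ?case by (simp add: left_linear_zero[OF dst_coord_left_linear])
  next
    case (dst_span_add_scale j a m)
    have c: "dst_coord i (m \<bullet> dst_basis j + a) = m * (if i = j then 1 else 0) + dst_coord i a" for i
      using dst_coord_left_linear[of i] dst_coord_basis[OF dst_span_add_scale(1)]
      by (simp add: left_linear_def)
    \<comment> \<open>The support is \<open>{j}\<close> or, for \<open>m = 0\<close>, empty.\<close>
    have s: "{i \<in> basis_index. m * (if i = j then 1 else 0) \<noteq> 0} \<subseteq> {j}" by auto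
    then have f: "finite {i \<in> basis_index. m * (if i = j then 1 else 0) \<noteq> 0}"
      by (rule finite_subset) simp
    have "(\<Sum>i | i \<in> basis_index \<and> m * (if i = j then 1 else 0) \<noteq> 0.
        (m * (if i = j then 1 else 0)) \<bullet> dst_basis i) = m \<bullet> dst_basis j"
      using sum_support_superset[OF _ s, of "\<lambda>i. (m * (if i = j then 1 else 0)) \<bullet> dst_basis i"]
        dst_span_add_scale(1) by simp
    then show ?case
      unfolding c
      using finite_support_sum_add[OF f dst_span_add_scale.IH[THEN conjunct1],
          of "\<lambda>i x. x \<bullet> dst_basis i"] dst_span_add_scale.IH
      by (simp add: m2_scale_add_left)
  qed
  then show "finite {i \<in> basis_index. dst_coord i a \<noteq> 0}"
    "a = (\<Sum>i | i \<in> basis_index \<and> dst_coord i a \<noteq> 0. dst_coord i a \<bullet> dst_basis i)"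
    by simp_all
qed


section \<open>The coaction formula\<close>

lemma tens_sum_left: "(\<Sum>i\<in>A. f i) \<otimes> x = (\<Sum>i\<in>A. f i \<otimes> x)"
  by (induction A rule: infinite_finite_induct) (simp_all add: tens_add_left)

lemma tens_conj_expansion:
  fixes x :: "'n::m2_module"
  shows "finite {i \<in> basis_index. dst_coord i (dst_conj a) \<bullet> x \<noteq> 0}"
    and "(\<Sum>i | i \<in> basis_index \<and> dst_coord i (dst_conj a) \<bullet> x \<noteq> 0.
        dst_conj (dst_basis i) \<otimes> (dst_coord i (dst_conj a) \<bullet> x)) = a \<otimes> x"
proof -
  let ?S = "{i \<in> basis_index. dst_coord i (dst_conj a) \<noteq> 0}"
  have S: "finite ?S" "{i \<in> basis_index. dst_coord i (dst_conj a) \<bullet> x \<noteq> 0} \<subseteq> ?S"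
    using finite_dst_coord by auto
  then show "finite {i \<in> basis_index. dst_coord i (dst_conj a) \<bullet> x \<noteq> 0}"
    by (rule rev_finite_subset)
  have "a = dst_conj (\<Sum>i\<in>?S. dst_coord i (dst_conj a) \<bullet> dst_basis i)"
    by (simp only: dst_conj_dst_conj flip: dst_coord_expansion)
  also have "\<dots> = (\<Sum>i\<in>?S. dst_conj (dst_basis i) * eta_R (dst_coord i (dst_conj a)))"
    by (simp add: ring_map_sum[OF dst_conj_ring_map] ring_mapD[OF dst_conj_ring_map]
        m2_scale_dual_steenrod_def dst_conj_eta_L mult.commute)
  finally have "a \<otimes> x = (\<Sum>i\<in>?S. dst_conj (dst_basis i) * eta_R (dst_coord i (dst_conj a))) \<otimes> x"
    by simp
  also have "\<dots> = (\<Sum>i\<in>?S. dst_conj (dst_basis i) \<otimes> (dst_coord i (dst_conj a) \<bullet> x))"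
    by (simp only: tens_sum_left tens_balanced)
  \<comment> \<open>Indices whose coordinate kills \<open>x\<close> contribute zero and may be
    dropped.\<close>
  also have "\<dots> = (\<Sum>i | i \<in> basis_index \<and> dst_coord i (dst_conj a) \<bullet> x \<noteq> 0.
        dst_conj (dst_basis i) \<otimes> (dst_coord i (dst_conj a) \<bullet> x))"
    by (rule sum_support_superset[OF S, symmetric]) auto
  finally show "(\<Sum>i | i \<in> basis_index \<and> dst_coord i (dst_conj a) \<bullet> x \<noteq> 0.
        dst_conj (dst_basis i) \<otimes> (dst_coord i (dst_conj a) \<bullet> x)) = a \<otimes> x" by simp
qed

text \<open>Every tensor is a finite sum of pure ones, and the expansions add up by
  \<open>finite_support_sum_add\<close>. For \<open>t = \<psi> n\<close> the coefficient
  \<open>h i t\<close> is the action of the dual basis element \<open>i\<close> on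
  \<open>n\<close>.\<close>

lemma tensor_conj_expansion:
  fixes t :: "'n::m2_module dst_tensor"
  defines "h \<equiv> \<lambda>i. tensor_lift (\<lambda>a x. dst_coord i (dst_conj a) \<bullet> x)"
  shows "finite {i \<in> basis_index. h i t \<noteq> 0} \<and>
    (\<Sum>i | i \<in> basis_index \<and> h i t \<noteq> 0. dst_conj (dst_basis i) \<otimes> h i t) = t"
proof (induction t rule: tensor_induct)
  case zero
  show ?case by (simp add: h_def)
next
  case (add a x t)
  have h: "h i (a \<otimes> x + t) = dst_coord i (dst_conj a) \<bullet> x + h i t" for i
    by (simp add: h_def tensor_lift_tens balanced_steenrod_action dst_coord_left_linear)
  show ?case
    unfolding h
    using finite_support_sum_add[OF tens_conj_expansion(1)[of a x] add[THEN conjunct1],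
        of "\<lambda>i y. dst_conj (dst_basis i) \<otimes> y"] tens_conj_expansion(2)[of a x] add
    by (simp add: tens_add_right)
qed

text \<open>The formally infinite sum is read as the sum over the indices with nonzero action; that
  there are finitely many of them is part of the claim.\<close>

theorem proposition3p4:
  fixes \<psi> :: "'n::m2_module \<Rightarrow> 'n dst_tensor" and n :: 'n
  assumes "left_comodule \<psi>"
  shows "finite {i \<in> basis_index. steenrod_action \<psi> (dual_basis i) n \<noteq> 0} \<and>
    \<psi> n = (\<Sum>i | i \<in> basis_index \<and> steenrod_action \<psi> (dual_basis i) n \<noteq> 0.
             dst_conj (dst_basis i) \<otimes> steenrod_action \<psi> (dual_basis i) n)"
proof -
  let ?h = "\<lambda>i. tensor_lift (\<lambda>a x. dst_coord i (dst_conj a) \<bullet> x) (\<psi> n)"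
  have act: "steenrod_action \<psi> (dual_basis i) n = ?h i" if "i \<in> basis_index" for i
    by (simp add: steenrod_action_def dual_basis_eq[OF that])
  then have "{i \<in> basis_index. steenrod_action \<psi> (dual_basis i) n \<noteq> 0} = {i \<in> basis_index. ?h i \<noteq> 0}"
    by auto
  moreover from this have "(\<Sum>i | i \<in> basis_index \<and> steenrod_action \<psi> (dual_basis i) n \<noteq> 0.
        dst_conj (dst_basis i) \<otimes> steenrod_action \<psi> (dual_basis i) n)
      = (\<Sum>i | i \<in> basis_index \<and> ?h i \<noteq> 0. dst_conj (dst_basis i) \<otimes> ?h i)"
    using act by (intro sum.cong) auto
  ultimately show ?thesis using tensor_conj_expansion[of "\<psi> n"] by simp
qed

end
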